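(* Let $M$ be a Riemannian manifold with a retraction $R$, let $f:M\to\mathbb{R}$ be a $C^1$ function, and let $C$ be an $R$-convex subset of $M$ equipped with a fixed $R$-convexity bundle $\{C_x\}_{x\in C}$. Assume that $\nabla f$ is $R$-Lipschitz over $C$, and fix $L>0$ such that $$\|\nabla(f\circ R_x)(\mathbf{v})-\nabla(f\circ R_x)(\mathbf{0}_x)\|_x\le L\|\mathbf{v}\|_x\quad\text{for every }x\in C\text{ and }\mathbf{v}\in C_x.$$ Fix a constant $s$ with $0<s<\frac{2}{L}$. For any $x_0\in C$, let $\{x_k\}_{k=0}^\infty$ be the sequence generated by $$x_{k+1}=R_{x_k}\bigl(\Pi_{C_{x_k}}(-s\nabla f(x_k))\bigr),\qquad k=0,1,2,\dots$$ Then every limit point of $\{x_k\}$ is a stationary point of $f|_C$.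
   Context: A retraction on a differentiable manifold $M$ is a $C^1$ map $R:TM\to M$ such that for every $x\in M$ the restriction $R_x=R|_{T_xM}$ satisfies $R_x(\mathbf{0}_x)=x$ (where $\mathbf 0_x$ is the zero vector of $T_xM$) and $dR_x|_{\mathbf{0}_x}=\mathrm{id}_{T_xM}$ under the identification $T_{\mathbf{0}_x}T_xM\cong T_xM$. For $x\in M$, $\langle\cdot,\cdot\rangle_x$ is the Riemannian inner product on $T_xM$ and $\|\cdot\|_x$ its norm. $\nabla f$ is the Riemannian gradient of $f$; $\nabla(f\circ R_x)$ is the gradient of the $C^1$ function $f\circ R_x:T_xM\to\mathbb{R}$ with respect to the inner product $\langle\cdot,\cdot\rangle_x$. $\nabla f$ is called $R$-Lipschitz over $C$ if there is a constant $L>0$ with $\|\nabla(f\circ R_x)(\mathbf{v})-\nabla(f\circ R_x)(\mathbf{0}_x)\|_x\le L\|\mathbf{v}\|_x$ for every $x\in C$, $\mathbf{v}\in C_x$. For a closed convex subset $K$ of a finite-dimensional inner product space $V$, $\Pi_K:V\to K$ is the nearest-point projection; $\Pi_{C_x}:T_xM\to C_x$ is taken with respect to $\langle\cdot,\cdot\rangle_x$. An $R$-convex subset of $M$ is a closed subset $C\subset M$ equipped with an $R$-convexity bundle, i.e. a collection $\{C_x\subset T_xM\mid x\in C\}$ satisfying: 1. (Fiber-wise convexity) $C_x$ is closed and convex in $T_xM$ for every $x\in C$. 2. (Local surjectivity) For every $x\in C$: (a) $R_x(C_x)\subset C$; (b) $\mathbf{0}_x\in C_x$; (c) there is a neighborhood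 $V_x$ of $\mathbf{0}_x$, open in $C_x$, such that $R_x(V_x)$ is a neighborhood of $x$ open in $C$ and $R_x|_{V_x}:V_x\to R_x(V_x)$ is a homeomorphism. 3. (Projective continuity) If $x_k\in C$ and $\mathbf{v}_k\in T_{x_k}M$ satisfy $x_k\to\tilde x\in C$ and $\mathbf{v}_k\to\tilde{\mathbf{v}}\in T_{\tilde x}M$ (convergence in $TM$), then $\Pi_{C_{x_k}}(\mathbf{v}_k)\to\Pi_{C_{\tilde x}}(\tilde{\mathbf{v}})$. A point $x^\ast\in C$ is a stationary point of $f|_C$ if $df|_{x^\ast}(\mathbf{v})\ge0$ for all $\mathbf{v}\in C_{x^\ast}$. A limit point of a sequence is the limit of some convergent subsequence. *)

theory Defs
  imports "HOL-Analysis.Analysis"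
begin

section \<open>Functions of class \<open>C\<^sup>k\<close> on open subsets of normed spaces\<close>

text \<open>Only meant for open \<open>S\<close>, where differentiability within \<open>S\<close> is differentiability; in
  finite dimension continuity of all directional derivatives is continuity of the derivative.\<close>

primrec Ck_on :: "nat \<Rightarrow> 'a::real_normed_vector set \<Rightarrow> ('a \<Rightarrow> 'b::real_normed_vector) \<Rightarrow> bool" where
  "Ck_on 0 S f \<longleftrightarrow> continuous_on S f"
| "Ck_on (Suc k) S f \<longleftrightarrow>
     f differentiable_on S \<and> (\<forall>v. Ck_on k S (\<lambda>x. frechet_derivative f (at x) v))"

definition Cinf_on :: "'a::real_normed_vector set \<Rightarrow> ('a \<Rightarrow> 'b::real_normed_vector) \<Rightarrow> bool" where
  "Cinf_on S f \<longleftrightarrow> (\<forall>k. Ck_on k S f)"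


section \<open>Smooth manifolds\<close>

text \<open>A chart is its domain together with a coordinate map, whose values outside the domain
  are irrelevant.\<close>

type_synonym ('a, 'e) chart = "'a set \<times> ('a \<Rightarrow> 'e)"

definition is_chart :: "'a topology \<Rightarrow> ('a, 'e::euclidean_space) chart \<Rightarrow> bool" where
  "is_chart X c \<longleftrightarrow> openin X (fst c) \<and> open (snd c ` fst c) \<and>
     homeomorphic_map (subtopology X (fst c)) (top_of_set (snd c ` fst c)) (snd c)"

definition chart_inv :: "('a, 'e) chart \<Rightarrow> 'e \<Rightarrow> 'a" where
  "chart_inv c = inv_into (fst c) (snd c)"

definition transition :: "('a, 'd) chart \<Rightarrow> ('a, 'e) chart \<Rightarrow> 'd \<Rightarrow> 'e" where
  "transition c d = snd d \<circ> chart_inv c"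

definition smooth_atlas :: "'a topology \<Rightarrow> ('a, 'e::euclidean_space) chart set \<Rightarrow> bool" where
  "smooth_atlas X A \<longleftrightarrow> (\<forall>c\<in>A. is_chart X c) \<and> (\<Union>c\<in>A. fst c) = topspace X \<and>
     (\<forall>c\<in>A. \<forall>d\<in>A. Cinf_on (snd c ` (fst c \<inter> fst d)) (transition c d))"

text \<open>The atlas need not be maximal: none of the notions below changes, up to the induced
  identification of tangent spaces, when it is enlarged to the maximal atlas containing it.\<close>

definition smooth_manifold :: "'a topology \<Rightarrow> ('a, 'e::euclidean_space) chart set \<Rightarrow> bool" where
  "smooth_manifold X A \<longleftrightarrow> Hausdorff_space X \<and> second_countable X \<and> smooth_atlas X A"

definition std_atlas :: "('e, 'e::euclidean_space) chart set" where
  "std_atlas = {(UNIV, \<lambda>v. v)}"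

definition C1_map :: "'a topology \<Rightarrow> ('a, 'd::euclidean_space) chart set \<Rightarrow>
    'b topology \<Rightarrow> ('b, 'e::euclidean_space) chart set \<Rightarrow> ('a \<Rightarrow> 'b) \<Rightarrow> bool" where
  "C1_map X A Y B F \<longleftrightarrow> continuous_map X Y F \<and>
     (\<forall>c\<in>A. \<forall>d\<in>B. Ck_on 1 (snd c ` (fst c \<inter> F -` fst d)) (snd d \<circ> F \<circ> chart_inv c))"

definition C1_function :: "'a topology \<Rightarrow> ('a, 'e::euclidean_space) chart set \<Rightarrow> ('a \<Rightarrow> real) \<Rightarrow> bool"
  where "C1_function X A f \<longleftrightarrow> C1_map X A euclidean std_atlas f"


section \<open>Tangent spaces and the tangent bundle\<close>

text \<open>For every point \<open>x\<close> a chart \<open>chart_at A x\<close> of the atlas around \<open>x\<close> is chosen, and a tangent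
  vector at \<open>x\<close> is represented by its coordinates in that chart. Each \<open>T\<^sub>xM\<close> is thus a copy of the
  model space \<open>'e\<close> with its vector space structure and topology, and a point of \<open>TM\<close> is a pair
  \<open>(x, v)\<close>. Since \<open>chart_at A x\<close> does not vary continuously with \<open>x\<close>, the topology of \<open>TM\<close> is
  not the product topology; it is the one making the bundle charts \<open>(y, w) \<mapsto> (c y, dc\<^sub>y w)\<close>
  homeomorphisms.\<close>

definition chart_at :: "('a, 'e) chart set \<Rightarrow> 'a \<Rightarrow> ('a, 'e) chart" where
  "chart_at A x = (SOME c. c \<in> A \<and> x \<in> fst c)"

text \<open>\<open>coord_change c d y\<close> turns the coordinates of a tangent vector at \<open>y\<close> in the chart \<open>c\<close>
  into its coordinates in the chart \<open>d\<close>.\<close>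

definition coord_change ::
    "('a, 'd::euclidean_space) chart \<Rightarrow> ('a, 'e::euclidean_space) chart \<Rightarrow> 'a \<Rightarrow> 'd \<Rightarrow> 'e" where
  "coord_change c d y = frechet_derivative (transition c d) (at (snd c y))"

definition bundle_chart :: "('a, 'e::euclidean_space) chart set \<Rightarrow> ('a, 'e) chart \<Rightarrow>
    ('a \<times> 'e, 'e \<times> 'e) chart" where
  "bundle_chart A c =
     (fst c \<times> UNIV, \<lambda>(y, w). (snd c y, coord_change (chart_at A y) c y w))"

definition tangent_atlas :: "('a, 'e::euclidean_space) chart set \<Rightarrow> ('a \<times> 'e, 'e \<times> 'e) chart set" where
  "tangent_atlas A = bundle_chart A ` A"

definition tangent_bundle :: "('a, 'e::euclidean_space) chart set \<Rightarrow> ('a \<times> 'e) topology" where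
  "tangent_bundle A =
     topology_generated_by {{p \<in> fst b. snd b p \<in> W} | b W. b \<in> tangent_atlas A \<and> open W}"

text \<open>The differential \<open>dF\<^sub>x : T\<^sub>xM \<rightarrow> T\<^bsub>F x\<^esub>N\<close>.\<close>

definition differential :: "('a, 'd::euclidean_space) chart set \<Rightarrow>
    ('b, 'e::euclidean_space) chart set \<Rightarrow> ('a \<Rightarrow> 'b) \<Rightarrow> 'a \<Rightarrow> 'd \<Rightarrow> 'e" where
  "differential A B F x =
     frechet_derivative (snd (chart_at B (F x)) \<circ> F \<circ> chart_inv (chart_at A x))
       (at (snd (chart_at A x) x))"


section \<open>Riemannian metrics\<close>

definition inner_product :: "('e::real_vector \<Rightarrow> 'e \<Rightarrow> real) \<Rightarrow> bool" where
  "inner_product ip \<longleftrightarrow> (\<forall>u. linear (ip u)) \<and> (\<forall>u v. ip u v = ip v u) \<and> (\<forall>v. v \<noteq> 0 \<longrightarrow> ip v v > 0)"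

definition ip_norm :: "('e::real_vector \<Rightarrow> 'e \<Rightarrow> real) \<Rightarrow> 'e \<Rightarrow> real" where
  "ip_norm ip v = sqrt (ip v v)"

text \<open>The vector representing the linear form \<open>l\<close> with respect to \<open>ip\<close>.\<close>

definition riesz :: "('e::real_vector \<Rightarrow> 'e \<Rightarrow> real) \<Rightarrow> ('e \<Rightarrow> real) \<Rightarrow> 'e" where
  "riesz ip l = (THE u. \<forall>w. ip u w = l w)"

text \<open>Gradient of a function on a vector space, with respect to \<open>ip\<close>.\<close>

definition ip_gradient ::
    "('e::euclidean_space \<Rightarrow> 'e \<Rightarrow> real) \<Rightarrow> ('e \<Rightarrow> real) \<Rightarrow> 'e \<Rightarrow> 'e" where
  "ip_gradient ip h v = riesz ip (frechet_derivative h (at v))"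

definition ip_projection :: "('e::real_vector \<Rightarrow> 'e \<Rightarrow> real) \<Rightarrow> 'e set \<Rightarrow> 'e \<Rightarrow> 'e" where
  "ip_projection ip K v = (THE p. p \<in> K \<and> (\<forall>q\<in>K. ip_norm ip (v - p) \<le> ip_norm ip (v - q)))"

text \<open>Smoothness of \<open>g\<close> is smoothness of its coefficients in every chart of the atlas.\<close>

definition riemannian_manifold :: "'a topology \<Rightarrow> ('a, 'e::euclidean_space) chart set \<Rightarrow>
    ('a \<Rightarrow> 'e \<Rightarrow> 'e \<Rightarrow> real) \<Rightarrow> bool" where
  "riemannian_manifold X A g \<longleftrightarrow> smooth_manifold X A \<and>
     (\<forall>x\<in>topspace X. inner_product (g x)) \<and>
     (\<forall>c\<in>A. \<forall>u w. Cinf_on (snd c ` fst c)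
        ((\<lambda>y. g y (coord_change c (chart_at A y) y u) (coord_change c (chart_at A y) y w))
          \<circ> chart_inv c))"

definition riemannian_gradient :: "('a, 'e::euclidean_space) chart set \<Rightarrow>
    ('a \<Rightarrow> 'e \<Rightarrow> 'e \<Rightarrow> real) \<Rightarrow> ('a \<Rightarrow> real) \<Rightarrow> 'a \<Rightarrow> 'e" where
  "riemannian_gradient A g f x = riesz (g x) (differential A std_atlas f x)"


section \<open>Retractions and \<open>R\<close>-convex sets\<close>

definition fiber_map :: "('a \<times> 'e \<Rightarrow> 'a) \<Rightarrow> 'a \<Rightarrow> 'e \<Rightarrow> 'a" where
  "fiber_map R x v = R (x, v)"

text \<open>In the last condition both sides are maps from \<open>T\<^sub>0(T\<^sub>xM) = T\<^sub>xM\<close> to \<open>T\<^sub>xM\<close>, expressed in the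
  coordinates of \<open>chart_at A x\<close>.\<close>

definition retraction_on_manifold ::
    "'a topology \<Rightarrow> ('a, 'e::euclidean_space) chart set \<Rightarrow> ('a \<times> 'e \<Rightarrow> 'a) \<Rightarrow> bool" where
  "retraction_on_manifold X A R \<longleftrightarrow>
     C1_map (tangent_bundle A) (tangent_atlas A) X A R \<and>
     (\<forall>x\<in>topspace X. fiber_map R x 0 = x \<and>
        differential std_atlas A (fiber_map R x) 0 = (\<lambda>v. v))"

definition R_convex :: "'a topology \<Rightarrow> ('a, 'e::euclidean_space) chart set \<Rightarrow>
    ('a \<Rightarrow> 'e \<Rightarrow> 'e \<Rightarrow> real) \<Rightarrow> ('a \<times> 'e \<Rightarrow> 'a) \<Rightarrow> 'a set \<Rightarrow> ('a \<Rightarrow> 'e set) \<Rightarrow> bool" where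
  "R_convex X A g R C K \<longleftrightarrow>
     closedin X C \<and>
     (\<forall>x\<in>C. closed (K x) \<and> convex (K x)) \<and>
     (\<forall>x\<in>C. fiber_map R x ` K x \<subseteq> C \<and> 0 \<in> K x \<and>
        (\<exists>V. openin (top_of_set (K x)) V \<and> 0 \<in> V \<and>
             openin (subtopology X C) (fiber_map R x ` V) \<and> x \<in> fiber_map R x ` V \<and>
             homeomorphic_map (top_of_set V) (subtopology X (fiber_map R x ` V)) (fiber_map R x))) \<and>
     (\<forall>y v y' v'.
        (\<forall>k. y k \<in> C) \<and> y' \<in> C \<and> limitin X y y' sequentially \<and>
        limitin (tangent_bundle A) (\<lambda>k. (y k, v k)) (y', v') sequentially \<longrightarrow>
        limitin (tangent_bundle A) (\<lambda>k. (y k, ip_projection (g (y k)) (K (y k)) (v k)))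
          (y', ip_projection (g y') (K y') v') sequentially)"

definition R_Lipschitz_gradient :: "('a \<Rightarrow> 'e::euclidean_space \<Rightarrow> 'e \<Rightarrow> real) \<Rightarrow>
    ('a \<times> 'e \<Rightarrow> 'a) \<Rightarrow> ('a \<Rightarrow> real) \<Rightarrow> 'a set \<Rightarrow> ('a \<Rightarrow> 'e set) \<Rightarrow> real \<Rightarrow> bool" where
  "R_Lipschitz_gradient g R f C K L \<longleftrightarrow> L > 0 \<and>
     (\<forall>x\<in>C. \<forall>v\<in>K x.
        ip_norm (g x) (ip_gradient (g x) (f \<circ> fiber_map R x) v
                       - ip_gradient (g x) (f \<circ> fiber_map R x) 0)
          \<le> L * ip_norm (g x) v)"

definition stationary_point :: "('a, 'e::euclidean_space) chart set \<Rightarrow> ('a \<Rightarrow> real) \<Rightarrow>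
    'a set \<Rightarrow> ('a \<Rightarrow> 'e set) \<Rightarrow> 'a \<Rightarrow> bool" where
  "stationary_point A f C K x \<longleftrightarrow> x \<in> C \<and> (\<forall>v\<in>K x. differential A std_atlas f x v \<ge> 0)"

definition limit_point :: "'a topology \<Rightarrow> (nat \<Rightarrow> 'a) \<Rightarrow> 'a \<Rightarrow> bool" where
  "limit_point X x l \<longleftrightarrow> (\<exists>r. strict_mono r \<and> limitin X (x \<circ> r) l sequentially)"

end

theory Submission
  imports Defs
begin

text \<open>
  Write \<open>p\<^sub>k = \<Pi>(- s \<nabla>f (x\<^sub>k))\<close> for the projected step. On the tangent space at \<open>x\<^sub>k\<close> the function
  \<open>h = f \<circ> R\<^bsub>x\<^sub>k\<^esub>\<close> has differential \<open>df\<close> at \<open>0\<close>, because the retraction has identity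
  differential there, and the Lipschitz bound along the segment from \<open>0\<close> to \<open>p\<^sub>k\<close> gives
  \<open>h p\<^sub>k \<le> h 0 + df p\<^sub>k + L/2 \<parallel>p\<^sub>k\<parallel>\<^sup>2\<close> (\<open>descent_inequality\<close>). Comparing \<open>p\<^sub>k\<close> with the
  competitor \<open>0\<close> in the variational inequality of the projection gives \<open>s df p\<^sub>k \<le> - \<parallel>p\<^sub>k\<parallel>\<^sup>2\<close>.
  Hence every step lowers \<open>f\<close> by at least \<open>c \<parallel>p\<^sub>k\<parallel>\<^sup>2\<close> with \<open>c = 1/s - L/2 > 0\<close>
  (\<open>projected_step_decrease\<close>).

  Now let a subsequence converge to \<open>l\<close>. By monotonicity and continuity \<open>f l\<close> is a lower bound
  of all \<open>f x\<^sub>k\<close>, so along the subsequence \<open>c \<parallel>p\<^sub>k\<parallel>\<^sup>2 \<le> f x\<^sub>k - f l\<close> tends to \<open>0\<close>. On the other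
  hand the gradients converge in \<open>TM\<close> to the gradient at \<open>l\<close> (\<open>riemannian_gradient_tendsto\<close>),
  projective continuity carries this over to \<open>p\<^sub>k\<close>, and the metric is continuous along sequences
  converging in \<open>TM\<close> (\<open>metric_tendsto\<close>). So the step at \<open>l\<close> has norm \<open>0\<close>, and the variational
  inequality at \<open>l\<close> becomes stationarity.

  The differential geometry consists in moving these statements into one chart around \<open>l\<close>: tangent
  vectors at different points are stored in unrelated coordinates, and only after a change to a
  common chart do the metric and the differential of \<open>f\<close> become continuous families of forms on
  the model space. There the gradient is a Riesz representative, and \<open>tendsto_riesz\<close> says that it
  depends continuously on the inner product and on the linear form.
\<close>

section \<open>Inner products, Riesz representatives and nearest points\<close>

lemma inner_product_linear: "inner_product ip \<Longrightarrow> linear (ip u)"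
  and inner_product_commute: "inner_product ip \<Longrightarrow> ip u v = ip v u"
  and inner_product_pos: "inner_product ip \<Longrightarrow> v \<noteq> 0 \<Longrightarrow> ip v v > 0"
  unfolding inner_product_def by blast+

lemma inner_product_bilinear:
  assumes "inner_product ip"
  shows "bilinear ip"
proof -
  have "(\<lambda>u. ip u v) = ip v" for v
    using inner_product_commute[OF assms, of _ v] by (rule ext)
  then show ?thesis
    using inner_product_linear[OF assms] by (simp add: bilinear_def)
qed

lemma inner_product_nonneg:
  assumes "inner_product ip"
  shows "ip v v \<ge> 0"
proof (cases "v = 0")
  case True
  then show ?thesis using linear_0[OF inner_product_linear[OF assms, of 0]] by simp
next
  case False
  then show ?thesis using inner_product_pos[OF assms, of v] by simp
qed

lemma inner_product_eq_0:
  assumes "inner_product ip" "ip v v \<le> 0"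
  shows "v = 0"
  using inner_product_pos[OF assms(1), of v] assms(2) by fastforce

lemma ip_norm_square: "inner_product ip \<Longrightarrow> (ip_norm ip v)\<^sup>2 = ip v v"
  by (simp add: ip_norm_def inner_product_nonneg)

lemma ip_norm_scale:
  assumes "inner_product ip" "t \<ge> 0"
  shows "ip_norm ip (t *\<^sub>R v) = t * ip_norm ip v"
proof -
  have "ip (t *\<^sub>R v) (t *\<^sub>R v) = t\<^sup>2 * ip v v"
    using inner_product_bilinear[OF assms(1)]
    by (simp add: bilinear_lmul bilinear_rmul power2_eq_square)
  then show ?thesis using assms by (simp add: ip_norm_def real_sqrt_mult)
qed

lemma ip_diff_square:
  assumes "inner_product ip"
  shows "ip (u - t *\<^sub>R v) (u - t *\<^sub>R v) = ip u u - 2 * t * ip u v + t\<^sup>2 * ip v v"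
proof -
  note b = inner_product_bilinear[OF assms]
  have "ip v u = ip u v" by (rule inner_product_commute[OF assms])
  then show ?thesis
    by (simp add: bilinear_lsub[OF b] bilinear_rsub[OF b] bilinear_lmul[OF b] bilinear_rmul[OF b]
        power2_eq_square algebra_simps)
qed

lemma ip_Cauchy_Schwarz:
  assumes "inner_product ip"
  shows "ip u v \<le> ip_norm ip u * ip_norm ip v"
proof (cases "v = 0")
  case True
  then show ?thesis
    using bilinear_rzero[OF inner_product_bilinear[OF assms]] by (simp add: ip_norm_def)
next
  case False
  then have pos: "ip v v > 0" by (rule inner_product_pos[OF assms])
  \<comment> \<open>The multiple of \<open>v\<close> closest to \<open>u\<close>, so that the residual gives the sharp bound.\<close>
  define t where "t = ip u v / ip v v"
  have "0 \<le> ip u u - 2 * t * ip u v + t\<^sup>2 * ip v v"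
    using inner_product_nonneg[OF assms, of "u - t *\<^sub>R v"] ip_diff_square[OF assms] by simp
  then have "(ip u v)\<^sup>2 \<le> ip u u * ip v v"
    using pos by (simp add: t_def field_simps power2_eq_square)
  then have "\<bar>ip u v\<bar> \<le> sqrt (ip u u * ip v v)" by (metis real_sqrt_abs real_sqrt_le_mono)
  then show ?thesis by (simp add: ip_norm_def real_sqrt_mult)
qed

text \<open>By compactness of the unit sphere, every inner product dominates a multiple of the given norm.
  This is what makes nearest points exist and makes the inversion in the Riesz representation
  stable under perturbation.\<close>

lemma inner_product_coercive:
  fixes ip :: "'e::euclidean_space \<Rightarrow> 'e \<Rightarrow> real"
  assumes "inner_product ip"
  obtains m where "m > 0" "\<And>a. m * (norm a)\<^sup>2 \<le> ip a a"
proof -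
  note b = inner_product_bilinear[OF assms]
  have bb: "bounded_bilinear ip" using b by (simp add: bilinear_conv_bounded_bilinear)
  have "continuous_on (sphere 0 1) (\<lambda>a. ip a a)"
    by (intro bounded_bilinear.continuous_on[OF bb] continuous_intros)
  moreover have "sphere (0::'e) 1 \<noteq> {}" by simp
  ultimately obtain z where z: "norm z = 1" "\<And>a. norm a = 1 \<Longrightarrow> ip z z \<le> ip a a"
    using continuous_attains_inf[of "sphere (0::'e) 1" "\<lambda>a. ip a a"] by (auto simp: dist_norm)
  have "ip z z > 0" using z(1) by (intro inner_product_pos[OF assms]) auto
  moreover have "ip z z * (norm a)\<^sup>2 \<le> ip a a" for a
  proof (cases "a = 0")
    case True then show ?thesis using bilinear_rzero[OF b] by simp
  next
    case False
    have "ip z z \<le> ip ((1 / norm a) *\<^sub>R a) ((1 / norm a) *\<^sub>R a)"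
      using False by (intro z(2)) simp
    also have "\<dots> = ip a a / (norm a)\<^sup>2"
      by (simp only: bilinear_lmul[OF b] bilinear_rmul[OF b]) (simp add: power2_eq_square)
    finally show ?thesis using False by (simp add: field_simps)
  qed
  ultimately show ?thesis using that by blast
qed

lemma riesz_unique:
  assumes "inner_product ip" "\<And>w. ip u w = l w" "\<And>w. ip u' w = l w"
  shows "u = u'"
proof -
  have "ip (u - u') (u - u') = 0"
    by (simp add: bilinear_lsub[OF inner_product_bilinear[OF assms(1)]] assms(2,3))
  then show ?thesis using inner_product_eq_0[OF assms(1), of "u - u'"] by simp
qed

lemma riesz_eqI:
  assumes "inner_product ip" "\<And>w. ip u w = l w"
  shows "riesz ip l = u"
  unfolding riesz_def
proof (rule the_equality)
  fix u' assume "\<forall>w. ip u' w = l w"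
  then show "u' = u" using riesz_unique[OF assms(1), of u' l u] assms(2) by simp
qed (simp add: assms(2))

text \<open>The map sending \<open>u\<close> to the values of \<open>ip u\<close> on an orthonormal basis of the model space is
  injective, hence onto in finite dimension.\<close>

lemma riesz:
  fixes ip :: "'e::euclidean_space \<Rightarrow> 'e \<Rightarrow> real"
  assumes "inner_product ip" "linear l"
  shows "ip (riesz ip l) w = l w"
proof -
  note b = inner_product_bilinear[OF assms(1)]
  define \<Phi> where "\<Phi> u = (\<Sum>i\<in>Basis. ip u i *\<^sub>R i)" for u
  have comp: "\<Phi> u \<bullet> i = ip u i" if "i \<in> Basis" for u i
    using that by (simp add: \<Phi>_def inner_sum_left_Basis)
  have determined: "ip u = k" if "linear k" "\<And>i. i \<in> Basis \<Longrightarrow> ip u i = k i" for u k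
    using that b linear_eq_stdbasis[of "ip u" k] unfolding bilinear_def by blast
  have lin: "linear \<Phi>"
    by (rule linearI)
       (simp_all add: \<Phi>_def bilinear_ladd[OF b] bilinear_lmul[OF b] sum.distrib scaleR_add_left
         scaleR_sum_right)
  have "u = 0" if "\<Phi> u = 0" for u
  proof -
    have "ip u = (\<lambda>_. 0)"
      using comp[of _ u] that by (intro determined linear_zero) simp
    then show ?thesis using inner_product_eq_0[OF assms(1), of u] by simp
  qed
  then have "surj \<Phi>" using lin linear_injective_0 linear_injective_imp_surjective by blast
  then obtain u where u: "\<Phi> u = (\<Sum>i\<in>Basis. l i *\<^sub>R i)" by (metis surj_def)
  have "ip u = l"
    using comp[of _ u] by (intro determined assms(2)) (simp add: u inner_sum_left_Basis)
  then show ?thesis using riesz_eqI[OF assms(1), of u l] by simp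
qed

lemma linear_bound_Basis:
  fixes l :: "'e::euclidean_space \<Rightarrow> real"
  assumes "linear l"
  shows "\<bar>l w\<bar> \<le> (\<Sum>i\<in>Basis. \<bar>l i\<bar>) * norm w"
proof -
  have "l w = l (\<Sum>i\<in>Basis. (w \<bullet> i) *\<^sub>R i)" by (simp add: euclidean_representation)
  also have "\<dots> = (\<Sum>i\<in>Basis. (w \<bullet> i) * l i)"
    by (simp add: linear_sum[OF assms] linear_cmul[OF assms])
  also have "\<bar>\<dots>\<bar> \<le> (\<Sum>i\<in>Basis. \<bar>l i\<bar> * norm w)"
    by (rule order_trans[OF sum_abs])
       (intro sum_mono, simp add: abs_mult Basis_le_norm mult.commute[of _ "norm w"] mult_right_mono)
  finally show ?thesis by (simp add: sum_distrib_right)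
qed

text \<open>The sum of the absolute entries serves as an operator norm. Applied to a difference of forms,
  it turns pointwise convergence of bilinear forms into uniform convergence on bounded sets.\<close>

lemma bilinear_bound_Basis:
  fixes B :: "'e::euclidean_space \<Rightarrow> 'e \<Rightarrow> real"
  assumes "bilinear B"
  shows "\<bar>B a b\<bar> \<le> (\<Sum>i\<in>Basis. \<Sum>j\<in>Basis. \<bar>B i j\<bar>) * norm a * norm b"
proof -
  have l1: "linear (B c)" and l2: "linear (\<lambda>x. B x c)" for c
    using assms unfolding bilinear_def by auto
  have "\<bar>B a b\<bar> \<le> (\<Sum>i\<in>Basis. \<bar>B i b\<bar>) * norm a" by (rule linear_bound_Basis[OF l2])
  also have "\<dots> \<le> (\<Sum>i\<in>Basis. (\<Sum>j\<in>Basis. \<bar>B i j\<bar>) * norm b) * norm a"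
    by (intro mult_right_mono sum_mono linear_bound_Basis[OF l1]) auto
  also have "\<dots> = (\<Sum>i\<in>Basis. \<Sum>j\<in>Basis. \<bar>B i j\<bar>) * norm a * norm b"
    by (simp add: sum_distrib_right[symmetric] mult_ac) (simp add: sum_distrib_left[symmetric])
  finally show ?thesis .
qed

lemma bilinear_diff: "bilinear B \<Longrightarrow> bilinear B' \<Longrightarrow> bilinear (\<lambda>a b. B a b - B' a b)"
  unfolding bilinear_def by (auto intro: linear_compose_sub)

lemma tendsto_bilinear_form:
  fixes B :: "'i \<Rightarrow> 'e::euclidean_space \<Rightarrow> 'e \<Rightarrow> real"
  assumes "\<forall>\<^sub>F k in F. bilinear (B k)" "bilinear B'"
    and lim: "\<And>a b. ((\<lambda>k. B k a b) \<longlongrightarrow> B' a b) F" and "(a \<longlongrightarrow> a') F" "(b \<longlongrightarrow> b') F"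
  shows "((\<lambda>k. B k (a k) (b k)) \<longlongrightarrow> B' a' b') F"
proof -
  have bb: "bounded_bilinear B'" using assms(2) by (simp add: bilinear_conv_bounded_bilinear)
  define D where "D k = (\<Sum>i\<in>Basis. \<Sum>j\<in>Basis. \<bar>B k i j - B' i j\<bar>) * norm (a k) * norm (b k)" for k
  have "(D \<longlongrightarrow> (\<Sum>i\<in>(Basis::'e set). \<Sum>j\<in>(Basis::'e set). \<bar>B' i j - B' i j\<bar>) * norm a' * norm b') F"
    unfolding D_def by (intro tendsto_intros assms)
  then have "(D \<longlongrightarrow> 0) F" by simp
  moreover have "\<forall>\<^sub>F k in F. norm (B k (a k) (b k) - B' (a k) (b k)) \<le> D k"
    using assms(1) by eventually_elim
      (use bilinear_bound_Basis[OF bilinear_diff[OF _ assms(2)]] in \<open>simp add: D_def\<close>)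
  ultimately have "((\<lambda>k. B k (a k) (b k) - B' (a k) (b k)) \<longlongrightarrow> 0) F"
    by (rule Lim_null_comparison[rotated])
  from tendsto_add[OF this bounded_bilinear.tendsto[OF bb assms(4,5)]] show ?thesis by simp
qed

text \<open>With \<open>e = u' k - u\<close>, subtracting the two defining equations gives
  \<open>B k e e = (l' k - l) e - (B k - ip) u e\<close>. The right-hand side is \<open>o(1) \<parallel>e\<parallel>\<close>, while the
  left-hand side is eventually at least \<open>m/2 \<parallel>e\<parallel>\<^sup>2\<close> with the coercivity constant \<open>m\<close> of the limit.\<close>

lemma tendsto_riesz:
  fixes B :: "'i \<Rightarrow> 'e::euclidean_space \<Rightarrow> 'e \<Rightarrow> real"
  assumes "inner_product ip" "linear l" "\<And>w. ip u w = l w"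
    and ev: "\<forall>\<^sub>F k in F. bilinear (B k) \<and> linear (l' k) \<and> (\<forall>w. B k (u' k) w = l' k w)"
    and limB: "\<And>a b. ((\<lambda>k. B k a b) \<longlongrightarrow> ip a b) F"
    and liml: "\<And>w. ((\<lambda>k. l' k w) \<longlongrightarrow> l w) F"
  shows "(u' \<longlongrightarrow> u) F"
proof -
  note b = inner_product_bilinear[OF assms(1)]
  obtain m where m: "m > 0" "\<And>a. m * (norm a)\<^sup>2 \<le> ip a a"
    using inner_product_coercive[OF assms(1)] by blast
  define D where "D k = (\<Sum>i\<in>Basis. \<Sum>j\<in>Basis. \<bar>B k i j - ip i j\<bar>)" for k
  define E where "E k = (\<Sum>i\<in>Basis. \<bar>l' k i - l i\<bar>)" for k
  have "(D \<longlongrightarrow> (\<Sum>i\<in>(Basis::'e set). \<Sum>j\<in>(Basis::'e set). \<bar>ip i j - ip i j\<bar>)) F"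
    unfolding D_def by (intro tendsto_intros limB)
  then have D0: "(D \<longlongrightarrow> 0) F" by simp
  have "(E \<longlongrightarrow> (\<Sum>i\<in>(Basis::'e set). \<bar>l i - l i\<bar>)) F"
    unfolding E_def by (intro tendsto_intros liml)
  then have E0: "(E \<longlongrightarrow> 0) F" by simp
  have "((\<lambda>k. 2 * (E k + D k * norm u) / m) \<longlongrightarrow> 2 * (0 + 0 * norm u) / m) F"
    using m(1) by (intro tendsto_intros D0 E0) auto
  then have "((\<lambda>k. 2 * (E k + D k * norm u) / m) \<longlongrightarrow> 0) F" by simp
  moreover have "\<forall>\<^sub>F k in F. norm (u' k - u) \<le> 2 * (E k + D k * norm u) / m"
    using ev order_tendstoD(2)[OF D0 half_gt_zero[OF m(1)]]
  proof (eventually_elim)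
    case (elim k)
    then have Bk: "bilinear (B k)" and lk: "linear (l' k)" and uk: "\<And>w. B k (u' k) w = l' k w"
      and Dk: "D k < m / 2" by auto
    define e where "e = u' k - u"
    have dev: "\<bar>B k a c - ip a c\<bar> \<le> D k * norm a * norm c" for a c
      using bilinear_bound_Basis[OF bilinear_diff[OF Bk b]] by (simp add: D_def)
    have devl: "\<bar>l' k w - l w\<bar> \<le> E k * norm w" for w
      using linear_bound_Basis[OF linear_compose_sub[OF lk assms(2)]] by (simp add: E_def)
    have "B k e e = (l' k e - l e) - (B k u e - ip u e)"
      by (simp add: e_def[symmetric] bilinear_lsub[OF Bk, of "u' k" u e, folded e_def] uk assms(3))
    also have "\<dots> \<le> E k * norm e + D k * norm u * norm e"
      using devl[of e] dev[of u e] by linarith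
    finally have 1: "B k e e \<le> E k * norm e + D k * norm u * norm e" .
    have "D k * norm e * norm e \<le> m / 2 * norm e * norm e"
      using Dk by (intro mult_right_mono) auto
    with 1 dev[of e e] m(2)[of e] have "m / 2 * norm e * norm e \<le> (E k + D k * norm u) * norm e"
      by (simp add: power2_eq_square algebra_simps abs_le_iff)
    then have "m / 2 * norm e \<le> E k + D k * norm u \<or> norm e = 0"
      by (metis mult_le_cancel_right_pos norm_ge_zero order_le_less)
    moreover have "0 \<le> E k" "0 \<le> D k" by (simp_all add: E_def D_def sum_nonneg)
    ultimately show ?case
      using m(1) by (auto simp: field_simps e_def)
  qed
  ultimately have "((\<lambda>k. u' k - u) \<longlongrightarrow> 0) F"
    by (rule Lim_null_comparison[rotated])
  then show ?thesis by (simp add: Lim_null[symmetric])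
qed

text \<open>Moving from \<open>p\<close> a small step \<open>t\<close> towards \<open>q\<close> stays in \<open>S\<close>. If the angle were acute, the squared
  distance \<open>r - 2 t a + t\<^sup>2 c\<close>, with \<open>r\<close> its value at \<open>p\<close>, would drop below \<open>r\<close> as soon as
  \<open>t c < 2 a\<close>.\<close>

lemma nearest_point_variational:
  assumes "inner_product ip" "convex S" "p \<in> S" "q \<in> S"
    and near: "\<And>q. q \<in> S \<Longrightarrow> ip_norm ip (v - p) \<le> ip_norm ip (v - q)"
  shows "ip (v - p) (q - p) \<le> 0"
proof (rule ccontr)
  define a where "a = ip (v - p) (q - p)"
  define c where "c = ip (q - p) (q - p)"
  assume "\<not> ?thesis"
  then have a: "a > 0" by (simp add: a_def)
  have c: "c \<ge> 0" by (simp add: c_def inner_product_nonneg[OF assms(1)])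
  \<comment> \<open>Any \<open>0 < t \<le> 1\<close> with \<open>t c < 2 a\<close> works; \<open>c + 1\<close> is visibly positive, while \<open>c\<close> is only known to be nonnegative.\<close>
  define t where "t = min 1 (a / (c + 1))"
  have t: "0 < t" "t \<le> 1" using a c by (auto simp: t_def)
  have "t * (c + 1) \<le> a / (c + 1) * (c + 1)"
    using c by (intro mult_right_mono) (auto simp: t_def)
  then have "t * (c + 1) \<le> a" using c by simp
  then have "t * c < 2 * a" using t a by (simp add: algebra_simps)
  then have lt: "t\<^sup>2 * c < 2 * t * a" using t by (simp add: power2_eq_square)
  have "p + t *\<^sub>R (q - p) \<in> S"
    using convexD_alt[OF assms(2,3,4), of t] t by (simp add: algebra_simps)
  from near[OF this] have "ip (v - p) (v - p) \<le> ip (v - p - t *\<^sub>R (q - p)) (v - p - t *\<^sub>R (q - p))"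
    by (simp add: ip_norm_def diff_diff_eq)
  also have "\<dots> = ip (v - p) (v - p) - 2 * t * a + t\<^sup>2 * c"
    unfolding a_def c_def by (rule ip_diff_square[OF assms(1)])
  finally show False using lt by simp
qed

lemma nearest_point_exists:
  fixes ip :: "'e::euclidean_space \<Rightarrow> 'e \<Rightarrow> real"
  assumes "inner_product ip" "closed S" "S \<noteq> {}"
  obtains p where "p \<in> S" "\<And>q. q \<in> S \<Longrightarrow> ip_norm ip (v - p) \<le> ip_norm ip (v - q)"
proof -
  obtain s where s: "s \<in> S" using assms(3) by blast
  obtain m where m: "m > 0" "\<And>a. m * (norm a)\<^sup>2 \<le> ip a a"
    using inner_product_coercive[OF assms(1)] by blast
  have bb: "bounded_bilinear ip"
    using inner_product_bilinear[OF assms(1)] by (simp add: bilinear_conv_bounded_bilinear)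
  have cont: "continuous_on T (\<lambda>q. ip (v - q) (v - q))" for T
    by (intro bounded_bilinear.continuous_on[OF bb] continuous_intros)
  define r where "r = ip (v - s) (v - s)"
  \<comment> \<open>Minimise over the compact part of \<open>S\<close> that does at least as well as a given point.\<close>
  define T where "T = S \<inter> {q. ip (v - q) (v - q) \<le> r}"
  have "T \<subseteq> cball v (sqrt (r / m))"
  proof
    fix q assume "q \<in> T"
    then have "m * (norm (v - q))\<^sup>2 \<le> r" using m(2)[of "v - q"] by (simp add: T_def)
    then have "(norm (v - q))\<^sup>2 \<le> r / m" using m(1) by (simp add: field_simps)
    then show "q \<in> cball v (sqrt (r / m))"
      by (simp add: dist_norm real_le_rsqrt)
  qed
  then have "bounded T" using bounded_subset bounded_cball by blast
  moreover have "closed T"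
    unfolding T_def using assms(2) cont by (intro closed_Int closed_Collect_le) auto
  ultimately have "compact T" by (simp add: compact_eq_bounded_closed)
  moreover have "T \<noteq> {}" using s by (auto simp: T_def r_def)
  ultimately obtain p where p: "p \<in> T" "\<And>q. q \<in> T \<Longrightarrow> ip (v - p) (v - p) \<le> ip (v - q) (v - q)"
    using continuous_attains_inf[OF _ _ cont, of T] by auto
  have "ip (v - p) (v - p) \<le> ip (v - q) (v - q)" if "q \<in> S" for q
    using p that by (cases "q \<in> T") (auto simp: T_def)
  then show ?thesis using that p(1) by (auto simp: T_def ip_norm_def)
qed

text \<open>Two nearest points satisfy each other's variational inequality; adding the two inequalities
  shows that they coincide, so the definite description in \<open>ip_projection\<close> denotes.\<close>

lemma ip_projection:
  fixes ip :: "'e::euclidean_space \<Rightarrow> 'e \<Rightarrow> real"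
  assumes "inner_product ip" "closed S" "convex S" "S \<noteq> {}"
  shows "ip_projection ip S v \<in> S"
    and "q \<in> S \<Longrightarrow> ip (v - ip_projection ip S v) (q - ip_projection ip S v) \<le> 0"
proof -
  note b = inner_product_bilinear[OF assms(1)]
  let ?P = "\<lambda>p. p \<in> S \<and> (\<forall>q\<in>S. ip_norm ip (v - p) \<le> ip_norm ip (v - q))"
  obtain p where p: "?P p" using nearest_point_exists[OF assms(1,2,4)] by metis
  have "p' = p" if p': "?P p'" for p'
  proof -
    have "ip (v - p) (p' - p) \<le> 0" "ip (v - p') (p - p') \<le> 0"
      using p p' by (auto intro!: nearest_point_variational[OF assms(1,3)])
    then have "ip (p' - p) (p' - p) \<le> 0"
      by (simp add: bilinear_lsub[OF b] bilinear_rsub[OF b])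
    then show ?thesis using inner_product_eq_0[OF assms(1), of "p' - p"] by simp
  qed
  then have "ip_projection ip S v = p"
    unfolding ip_projection_def using p by (intro the_equality) blast+
  then show "ip_projection ip S v \<in> S"
    and "q \<in> S \<Longrightarrow> ip (v - ip_projection ip S v) (q - ip_projection ip S v) \<le> 0"
    using p nearest_point_variational[OF assms(1,3), of p q v] by auto
qed

section \<open>Charts and changes of tangent coordinates\<close>

lemma is_chart_inj: "is_chart X c \<Longrightarrow> inj_on (snd c) (fst c)"
  unfolding is_chart_def homeomorphic_eq_everything_map
  by (metis openin_subset topspace_subtopology_subset)

lemma chart_inv_left: "is_chart X c \<Longrightarrow> y \<in> fst c \<Longrightarrow> chart_inv c (snd c y) = y"
  unfolding chart_inv_def by (rule inv_into_f_f[OF is_chart_inj])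

lemma is_chart_open_image:
  assumes "is_chart X c" "openin X U"
  shows "open (snd c ` (fst c \<inter> U))"
proof -
  have "openin (subtopology X (fst c)) (fst c \<inter> U)"
    using assms(2) by (rule openin_subtopology_Int2)
  then have "openin (top_of_set (snd c ` fst c)) (snd c ` (fst c \<inter> U))"
    using assms(1) unfolding is_chart_def homeomorphic_eq_everything_map open_map_def by blast
  then show ?thesis using assms(1) unfolding is_chart_def by (auto intro: openin_open_trans)
qed

lemma is_chart_open: "is_chart X c \<Longrightarrow> open (snd c ` fst c)"
  by (simp add: is_chart_def)

lemma is_chart_tendsto:
  assumes "is_chart X c" "limitin X y l F" "l \<in> fst c"
  shows "\<forall>\<^sub>F k in F. y k \<in> fst c" "((\<lambda>k. snd c (y k)) \<longlongrightarrow> snd c l) F"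
proof -
  have op: "openin X (fst c)" using assms(1) by (simp add: is_chart_def)
  show ev: "\<forall>\<^sub>F k in F. y k \<in> fst c" using limitinD[OF assms(2) op assms(3)] .
  have "continuous_map (subtopology X (fst c)) (top_of_set (snd c ` fst c)) (snd c)"
    using assms(1) unfolding is_chart_def by (auto dest: homeomorphic_imp_continuous_map)
  then have "continuous_map (subtopology X (fst c)) euclidean (snd c)"
    by (rule continuous_map_into_fulltopology)
  moreover have "limitin (subtopology X (fst c)) y l F"
    using assms(2,3) ev by (simp add: limitin_subtopology)
  ultimately have "limitin euclidean (snd c \<circ> y) (snd c l) F"
    by (rule continuous_map_limit)
  then show "((\<lambda>k. snd c (y k)) \<longlongrightarrow> snd c l) F" by (simp add: comp_def)
qed

lemma chart_coordinate_tendsto: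
  assumes "is_chart X c" "limitin X y l F" "l \<in> fst c" "continuous_on (snd c ` fst c) G"
  shows "((\<lambda>k. G (snd c (y k))) \<longlongrightarrow> G (snd c l)) F"
  by (rule continuous_on_tendsto_compose[OF assms(4) is_chart_tendsto(2)[OF assms(1-3)]])
     (use is_chart_tendsto(1)[OF assms(1-3)] assms(3) in \<open>auto elim: eventually_mono\<close>)

lemma smooth_atlas_chart: "smooth_atlas X A \<Longrightarrow> c \<in> A \<Longrightarrow> is_chart X c"
  by (simp add: smooth_atlas_def)

lemma chart_at:
  assumes "smooth_atlas X A" "y \<in> topspace X"
  shows "chart_at A y \<in> A" "y \<in> fst (chart_at A y)"
proof -
  have "\<exists>c. c \<in> A \<and> y \<in> fst c" using assms unfolding smooth_atlas_def by blast
  then show "chart_at A y \<in> A" "y \<in> fst (chart_at A y)"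
    unfolding chart_at_def by (metis (mono_tags, lifting) someI_ex)+
qed

text \<open>This certifies that \<open>coord_change\<close>, defined by the total function \<open>frechet_derivative\<close>, is a
  genuine derivative at every point of the overlap.\<close>

lemma transition_has_derivative:
  assumes "smooth_atlas X A" "c \<in> A" "d \<in> A" "y \<in> fst c" "y \<in> fst d"
  shows "(transition c d has_derivative coord_change c d y) (at (snd c y))"
proof -
  let ?S = "snd c ` (fst c \<inter> fst d)"
  have "open ?S"
    using assms smooth_atlas_chart is_chart_open_image unfolding is_chart_def by metis
  moreover have "Ck_on (Suc 0) ?S (transition c d)"
    using assms unfolding smooth_atlas_def Cinf_on_def by blast
  ultimately have "transition c d differentiable at (snd c y)"
    using assms(4,5) by (auto simp: differentiable_on_eq_differentiable_at)
  then show ?thesis by (simp add: coord_change_def frechet_derivative_works)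
qed

lemma linear_coord_change:
  assumes "smooth_atlas X A" "c \<in> A" "d \<in> A" "y \<in> fst c" "y \<in> fst d"
  shows "linear (coord_change c d y)"
  using transition_has_derivative[OF assms] by (rule has_derivative_linear)

text \<open>The chain rule for \<open>F \<circ> chart_inv c = (F \<circ> chart_inv d) \<circ> transition c d\<close>, an identity valid on
  the coordinate image of the overlap. With coordinate maps for \<open>F\<close> it yields the cocycle rule, and
  with scalar functions it yields the transformation of differentials.\<close>

lemma has_derivative_change_chart:
  assumes at: "smooth_atlas X A" and c: "c \<in> A" "y \<in> fst c" and d: "d \<in> A" "y \<in> fst d"
    and F: "(F \<circ> chart_inv d has_derivative D) (at (snd d y))"
  shows "(F \<circ> chart_inv c has_derivative D \<circ> coord_change c d y) (at (snd c y))"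
proof -
  note ch = smooth_atlas_chart[OF at c(1)] smooth_atlas_chart[OF at d(1)]
  have val: "transition c d (snd c z) = snd d z" if "z \<in> fst c" for z
    using chart_inv_left[OF ch(1) that] by (simp add: transition_def)
  have "((F \<circ> chart_inv d) \<circ> transition c d has_derivative D \<circ> coord_change c d y) (at (snd c y))"
    using F by (intro diff_chain_at transition_has_derivative[OF at c(1) d(1) c(2) d(2)])
      (simp add: val c(2))
  then show ?thesis
  proof (rule has_derivative_transform_within_open)
    show "open (snd c ` (fst c \<inter> fst d))"
      using ch by (intro is_chart_open_image) (auto simp: is_chart_def)
    show "snd c y \<in> snd c ` (fst c \<inter> fst d)" using c d by blast
    fix e assume "e \<in> snd c ` (fst c \<inter> fst d)"
    then obtain z where z: "z \<in> fst c" "z \<in> fst d" "e = snd c z" by blast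
    then show "((F \<circ> chart_inv d) \<circ> transition c d) e = (F \<circ> chart_inv c) e"
      by (simp add: val chart_inv_left[OF ch(1)] chart_inv_left[OF ch(2)])
  qed
qed

lemma coord_change_compose:
  assumes "smooth_atlas X A" "c \<in> A" "y \<in> fst c" "d \<in> A" "y \<in> fst d" "e \<in> A" "y \<in> fst e"
  shows "coord_change d e y (coord_change c d y v) = coord_change c e y v"
proof -
  have "(transition c e has_derivative coord_change d e y \<circ> coord_change c d y) (at (snd c y))"
    using has_derivative_change_chart[of X A c y d "snd e"] assms
      transition_has_derivative[of X A d e y] unfolding transition_def by blast
  with transition_has_derivative[of X A c e y] assms
  have "coord_change c e y = coord_change d e y \<circ> coord_change c d y"
    using has_derivative_unique by blast
  then show ?thesis by simp
qed

lemma coord_change_self: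
  assumes "smooth_atlas X A" "c \<in> A" "y \<in> fst c"
  shows "coord_change c c y v = v"
proof -
  note ch = smooth_atlas_chart[OF assms(1,2)]
  have "((\<lambda>e. e) has_derivative coord_change c c y) (at (snd c y))"
    by (rule has_derivative_transform_within_open
        [OF transition_has_derivative[OF assms(1,2,2,3,3)] is_chart_open[OF ch]])
       (use assms(3) in \<open>auto simp: transition_def chart_inv_left[OF ch]\<close>)
  then have "coord_change c c y = (\<lambda>v. v)"
    using has_derivative_unique has_derivative_ident by blast
  then show ?thesis by simp
qed

lemma coord_change_inverse:
  assumes "smooth_atlas X A" "c \<in> A" "y \<in> fst c" "d \<in> A" "y \<in> fst d"
  shows "coord_change d c y (coord_change c d y v) = v"
  by (simp add: coord_change_compose[OF assms assms(2,3)] coord_change_self[OF assms(1-3)])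

section \<open>Convergence in the tangent bundle\<close>

text \<open>The sets in which the sequence eventually lies whenever the limit does are closed under finite
  intersections and unions, so a subbasis suffices.\<close>

lemma limitin_topology_generated_by:
  "limitin (topology_generated_by \<S>) p q F \<longleftrightarrow>
     q \<in> \<Union>\<S> \<and> (\<forall>U\<in>\<S>. q \<in> U \<longrightarrow> (\<forall>\<^sub>F k in F. p k \<in> U))"
proof
  assume "limitin (topology_generated_by \<S>) p q F"
  then show "q \<in> \<Union>\<S> \<and> (\<forall>U\<in>\<S>. q \<in> U \<longrightarrow> (\<forall>\<^sub>F k in F. p k \<in> U))"
    unfolding limitin_def topology_generated_by_topspace
    using topology_generated_by_Basis by blast
next
  assume *: "q \<in> \<Union>\<S> \<and> (\<forall>U\<in>\<S>. q \<in> U \<longrightarrow> (\<forall>\<^sub>F k in F. p k \<in> U))"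
  have "q \<in> U \<longrightarrow> (\<forall>\<^sub>F k in F. p k \<in> U)" if "generate_topology_on \<S> U" for U
    using that
  proof (induction rule: generate_topology_on.induct)
    case (Int a b)
    then show ?case by (auto intro: eventually_elim2)
  next
    case (UN K)
    show ?case
    proof
      assume "q \<in> \<Union>K"
      then obtain k where k: "k \<in> K" "q \<in> k" by blast
      then have "\<forall>\<^sub>F j in F. p j \<in> k" using UN.IH by blast
      then show "\<forall>\<^sub>F j in F. p j \<in> \<Union>K" by (rule eventually_mono) (use k(1) in blast)
    qed
  qed (use * in auto)
  then show "limitin (topology_generated_by \<S>) p q F"
    using * by (auto simp: limitin_def topology_generated_by_topspace openin_topology_generated_by_iff)
qed

lemma bundle_chart_apply:
  "snd (bundle_chart A c) (y, w) = (snd c y, coord_change (chart_at A y) c y w)"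
  by (simp add: bundle_chart_def)

lemma fst_bundle_chart: "fst (bundle_chart A c) = fst c \<times> UNIV"
  by (simp add: bundle_chart_def)

text \<open>Preimages of open sets under the bundle charts, written out in coordinates; they form a subbasis
  of the topology of \<open>TM\<close>.\<close>

definition bundle_box :: "('a, 'e::euclidean_space) chart set \<Rightarrow> ('a, 'e) chart \<Rightarrow> ('e \<times> 'e) set \<Rightarrow> ('a \<times> 'e) set"
  where "bundle_box A c W = {(y, w). y \<in> fst c \<and> (snd c y, coord_change (chart_at A y) c y w) \<in> W}"

definition bundle_boxes :: "('a, 'e::euclidean_space) chart set \<Rightarrow> ('a \<times> 'e) set set"
  where "bundle_boxes A = {bundle_box A c W | c W. c \<in> A \<and> open W}"

lemma bundle_boxesI: "c \<in> A \<Longrightarrow> open W \<Longrightarrow> bundle_box A c W \<in> bundle_boxes A"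
  unfolding bundle_boxes_def by blast

lemma bundle_box_eq: "{p \<in> fst (bundle_chart A c). snd (bundle_chart A c) p \<in> W} = bundle_box A c W"
  by (auto simp: bundle_box_def bundle_chart_def)

lemma tangent_bundle_generated: "tangent_bundle A = topology_generated_by (bundle_boxes A)"
  unfolding tangent_bundle_def tangent_atlas_def bundle_boxes_def
proof (rule arg_cong[of _ _ topology_generated_by], intro equalityI subsetI)
  fix U assume "U \<in> {{p \<in> fst b. snd b p \<in> W} | b W. b \<in> bundle_chart A ` A \<and> open W}"
  then obtain c W where "c \<in> A" "open W" "U = bundle_box A c W"
    unfolding bundle_box_eq[symmetric] by blast
  then show "U \<in> {bundle_box A c W | c W. c \<in> A \<and> open W}" by blast
next
  fix U assume "U \<in> {bundle_box A c W | c W. c \<in> A \<and> open W}"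
  then show "U \<in> {{p \<in> fst b. snd b p \<in> W} | b W. b \<in> bundle_chart A ` A \<and> open W}"
    unfolding bundle_box_eq[symmetric] by blast
qed

text \<open>This and \<open>limitin_tangent_bundle\<close> together say that convergence in \<open>TM\<close> is convergence of the
  base points along with convergence of the vector coordinates in each chart around the limit,
  rather than in the chosen charts \<open>chart_at A (y k)\<close>, which may jump with \<open>k\<close>.\<close>

lemma tangent_bundle_chart_tendsto:
  assumes "limitin (tangent_bundle A) (\<lambda>k. (y k, v k)) (l, w) F" "c \<in> A" "l \<in> fst c"
  shows "((\<lambda>k. coord_change (chart_at A (y k)) c (y k) (v k))
           \<longlongrightarrow> coord_change (chart_at A l) c l w) F"
proof -
  let ?b = "\<lambda>y v. (snd c y, coord_change (chart_at A y) c y v)"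
  have "\<forall>\<^sub>F k in F. ?b (y k) (v k) \<in> W" if "open W" "?b l w \<in> W" for W
  proof -
    have "bundle_box A c W \<in> bundle_boxes A" using assms(2) that(1) by (rule bundle_boxesI)
    moreover have "(l, w) \<in> bundle_box A c W" using assms(3) that(2) by (simp add: bundle_box_def)
    ultimately have "\<forall>\<^sub>F k in F. (y k, v k) \<in> bundle_box A c W"
      using assms(1) unfolding tangent_bundle_generated limitin_topology_generated_by by blast
    then show ?thesis by (rule eventually_mono) (simp add: bundle_box_def)
  qed
  then have "((\<lambda>k. ?b (y k) (v k)) \<longlongrightarrow> ?b l w) F" by (rule topological_tendstoI)
  from tendsto_snd[OF this] show ?thesis by simp
qed

lemma Union_bundle_boxes:
  assumes at: "smooth_atlas X A"
  shows "\<Union>(bundle_boxes A) = topspace X \<times> UNIV"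
proof
  have "bundle_box A c W \<subseteq> topspace X \<times> UNIV" if "c \<in> A" for c W
    using that at by (auto simp: bundle_box_def smooth_atlas_def)
  then show "\<Union>(bundle_boxes A) \<subseteq> topspace X \<times> UNIV"
    unfolding bundle_boxes_def by (intro Union_least) auto
  show "topspace X \<times> UNIV \<subseteq> \<Union>(bundle_boxes A)"
  proof
    fix p assume "p \<in> topspace X \<times> (UNIV::'b set)"
    then have "fst p \<in> topspace X" by auto
    note d = chart_at[OF at this]
    have "p \<in> bundle_box A (chart_at A (fst p)) UNIV"
      using d(2) by (auto simp: bundle_box_def)
    moreover have "bundle_box A (chart_at A (fst p)) UNIV \<in> bundle_boxes A"
      using d(1) open_UNIV by (rule bundle_boxesI)
    ultimately show "p \<in> \<Union>(bundle_boxes A)" by (rule UnionI[rotated])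
  qed
qed

lemma topspace_tangent_bundle: "smooth_atlas X A \<Longrightarrow> topspace (tangent_bundle A) = topspace X \<times> UNIV"
  by (simp only: tangent_bundle_generated topology_generated_by_topspace Union_bundle_boxes)

lemma limitin_tangent_bundle:
  assumes at: "smooth_atlas X A" and lim: "limitin X y l F"
    and coord: "\<And>c. c \<in> A \<Longrightarrow> l \<in> fst c \<Longrightarrow> ((\<lambda>k. coord_change (chart_at A (y k)) c (y k) (v k))
           \<longlongrightarrow> coord_change (chart_at A l) c l w) F"
  shows "limitin (tangent_bundle A) (\<lambda>k. (y k, v k)) (l, w) F"
  unfolding tangent_bundle_generated limitin_topology_generated_by
proof (intro conjI ballI impI)
  show "(l, w) \<in> \<Union>(bundle_boxes A)"
    using limitin_topspace[OF lim] by (simp only: Union_bundle_boxes[OF at]) simp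
next
  fix U assume "U \<in> bundle_boxes A" "(l, w) \<in> U"
  then obtain c W where c: "c \<in> A" "l \<in> fst c" and U: "U = bundle_box A c W"
    and W: "open W" "(snd c l, coord_change (chart_at A l) c l w) \<in> W"
    by (auto simp: bundle_boxes_def bundle_box_def)
  note t = is_chart_tendsto[OF smooth_atlas_chart[OF at c(1)] lim c(2)]
  have "\<forall>\<^sub>F k in F. (snd c (y k), coord_change (chart_at A (y k)) c (y k) (v k)) \<in> W"
    using tendsto_Pair[OF t(2) coord[OF c]] W by (rule topological_tendstoD)
  with t(1) show "\<forall>\<^sub>F k in F. (y k, v k) \<in> U"
    by eventually_elim (simp add: U bundle_box_def)
qed

text \<open>On a single fiber the bundle charts are coordinate changes, which are linear and hence continuous.
  Composition with \<open>R\<close> shows that each \<open>R\<^sub>x\<close> is continuous.\<close>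

lemma continuous_map_tangent_fiber:
  fixes A :: "('a, 'e::euclidean_space) chart set"
  assumes at: "smooth_atlas X A" and x: "x \<in> topspace X"
  shows "continuous_map euclidean (tangent_bundle A) (\<lambda>v. (x, v))"
  unfolding tangent_bundle_generated
proof (rule continuous_on_generated_topo)
  fix U assume "U \<in> bundle_boxes A"
  then obtain c W where c: "c \<in> A" and W: "open W" and U: "U = bundle_box A c W"
    by (auto simp: bundle_boxes_def)
  have "open ((\<lambda>v. (x, v)) -` U)"
  proof (cases "x \<in> fst c")
    case True
    have "linear (coord_change (chart_at A x) c x)"
      by (rule linear_coord_change[OF at chart_at(1)[OF at x] c chart_at(2)[OF at x] True])
    then have "continuous_on UNIV (\<lambda>v. (snd c x, coord_change (chart_at A x) c x v))"
      by (intro continuous_on_Pair continuous_on_const linear_continuous_on)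
         (simp add: linear_conv_bounded_linear)
    then have "open ((\<lambda>v. (snd c x, coord_change (chart_at A x) c x v)) -` W)"
      by (rule open_vimage[OF W])
    moreover have "(\<lambda>v. (x, v)) -` U = (\<lambda>v. (snd c x, coord_change (chart_at A x) c x v)) -` W"
      using True by (auto simp: U bundle_box_def)
    ultimately show ?thesis by simp
  next
    case False
    then have "(\<lambda>v. (x, v)) -` U = {}" by (auto simp: U bundle_box_def)
    then show ?thesis by simp
  qed
  then show "openin euclidean ((\<lambda>v. (x, v)) -` U \<inter> topspace euclidean)" by simp
next
  show "(\<lambda>v. (x, v)) ` topspace euclidean \<subseteq> \<Union>(bundle_boxes A)"
    unfolding Union_bundle_boxes[OF at] using x by auto
qed

section \<open>The metric and the gradient in a chart\<close>

lemma chart_at_std_atlas: "chart_at std_atlas z = (UNIV, \<lambda>v. v)"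
  unfolding chart_at_def std_atlas_def by (rule some_equality) auto

lemma chart_inv_std: "chart_inv (UNIV, \<lambda>v. v) = (\<lambda>v. v)"
  by (rule ext) (simp add: chart_inv_def inv_into_f_f[of "\<lambda>v. v", simplified])

lemma differential_std_codomain:
  "differential A std_atlas f y
     = frechet_derivative (f \<circ> chart_inv (chart_at A y)) (at (snd (chart_at A y) y))"
  by (simp add: differential_def chart_at_std_atlas comp_def)

lemma differential_std_domain:
  "differential std_atlas A F v = frechet_derivative (snd (chart_at A (F v)) \<circ> F) (at v)"
  by (simp add: differential_def chart_at_std_atlas chart_inv_std comp_def)

lemma C1_function_chart:
  assumes "smooth_atlas X A" "C1_function X A f" "c \<in> A"
  shows "y \<in> fst c \<Longrightarrow> f \<circ> chart_inv c differentiable at (snd c y)"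
    and "continuous_on (snd c ` fst c) (\<lambda>e. frechet_derivative (f \<circ> chart_inv c) (at e) v)"
proof -
  have "\<forall>d\<in>{(UNIV, \<lambda>v. v)}. Ck_on 1 (snd c ` (fst c \<inter> f -` fst d)) (snd d \<circ> f \<circ> chart_inv c)"
    using assms(2,3) unfolding C1_function_def C1_map_def std_atlas_def by blast
  then have *: "Ck_on (Suc 0) (snd c ` fst c) (f \<circ> chart_inv c)" by (simp add: comp_def)
  then show "y \<in> fst c \<Longrightarrow> f \<circ> chart_inv c differentiable at (snd c y)"
    using is_chart_open[OF smooth_atlas_chart[OF assms(1,3)]]
    by (simp add: differentiable_on_eq_differentiable_at)
  show "continuous_on (snd c ` fst c) (\<lambda>e. frechet_derivative (f \<circ> chart_inv c) (at e) v)"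
    using * by simp
qed

lemma differential_has_derivative:
  assumes at: "smooth_atlas X A" and f: "C1_function X A f" and y: "y \<in> topspace X"
  shows "(f \<circ> chart_inv (chart_at A y) has_derivative differential A std_atlas f y)
           (at (snd (chart_at A y) y))"
  using C1_function_chart(1)[OF at f chart_at[OF at y]]
  by (simp add: differential_std_codomain frechet_derivative_works)

lemma linear_differential:
  assumes "smooth_atlas X A" "C1_function X A f" "y \<in> topspace X"
  shows "linear (differential A std_atlas f y)"
  using differential_has_derivative[OF assms] by (rule has_derivative_linear)

text \<open>The differential is stored in the coordinates of \<open>chart_at A y\<close>. Carried over to a fixed chart it
  is the derivative of the local representative, which varies continuously with \<open>y\<close>.\<close>

lemma differential_in_chart:
  assumes at: "smooth_atlas X A" and f: "C1_function X A f" and c: "c \<in> A" "y \<in> fst c"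
  shows "differential A std_atlas f y (coord_change c (chart_at A y) y w)
           = frechet_derivative (f \<circ> chart_inv c) (at (snd c y)) w"
proof -
  have y: "y \<in> topspace X" using at c unfolding smooth_atlas_def by blast
  have "(f \<circ> chart_inv c has_derivative
      differential A std_atlas f y \<circ> coord_change c (chart_at A y) y) (at (snd c y))"
    by (rule has_derivative_change_chart
        [OF at c chart_at[OF at y] differential_has_derivative[OF at f y]])
  from frechet_derivative_at[OF this] show ?thesis by (metis comp_apply)
qed

lemma inner_product_pullback:
  assumes "inner_product ip" "linear T" "\<And>v. T v = 0 \<Longrightarrow> v = 0"
  shows "inner_product (\<lambda>a b. ip (T a) (T b))"
  unfolding inner_product_def
proof (intro conjI allI impI)
  show "linear (\<lambda>b. ip (T a) (T b))" for a
    using linear_compose[OF assms(2) inner_product_linear[OF assms(1)]] by (simp add: comp_def)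
  show "ip (T a) (T b) = ip (T b) (T a)" for a b by (rule inner_product_commute[OF assms(1)])
  show "0 < ip (T v) (T v)" if "v \<noteq> 0" for v
    using that assms(3) by (intro inner_product_pos[OF assms(1)]) auto
qed

text \<open>The coefficients of \<open>g\<close> at \<open>y\<close> in the coordinates of \<open>c\<close>: unlike \<open>g y\<close> itself, these are
  forms on the model space that can be compared for different \<open>y\<close>.\<close>

definition metric_in_chart :: "('a, 'e::euclidean_space) chart set \<Rightarrow> ('a \<Rightarrow> 'e \<Rightarrow> 'e \<Rightarrow> real) \<Rightarrow>
    ('a, 'e) chart \<Rightarrow> 'a \<Rightarrow> 'e \<Rightarrow> 'e \<Rightarrow> real" where
  "metric_in_chart A g c y u w =
     g y (coord_change c (chart_at A y) y u) (coord_change c (chart_at A y) y w)"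

lemma riemannian_manifold_atlas: "riemannian_manifold X A g \<Longrightarrow> smooth_atlas X A"
  by (simp add: riemannian_manifold_def smooth_manifold_def)

lemma riemannian_manifold_inner:
  "riemannian_manifold X A g \<Longrightarrow> y \<in> topspace X \<Longrightarrow> inner_product (g y)"
  by (simp add: riemannian_manifold_def)

lemma metric_in_chart_inner:
  assumes M: "riemannian_manifold X A g" and c: "c \<in> A" "y \<in> fst c"
  shows "inner_product (metric_in_chart A g c y)"
proof -
  note at = riemannian_manifold_atlas[OF M]
  have y: "y \<in> topspace X" using at c unfolding smooth_atlas_def by blast
  note d = chart_at[OF at y]
  have inj: "v = 0" if "coord_change c (chart_at A y) y v = 0" for v
    using coord_change_inverse[OF at c d, of v] that linear_0[OF linear_coord_change[OF at d(1) c(1) d(2) c(2)]]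
    by simp
  show ?thesis
    unfolding metric_in_chart_def
    by (rule inner_product_pullback[OF riemannian_manifold_inner[OF M y]
        linear_coord_change[OF at c(1) d(1) c(2) d(2)] inj])
qed

lemma metric_in_chart_coord_change:
  assumes "smooth_atlas X A" "y \<in> topspace X" "c \<in> A" "y \<in> fst c"
  shows "metric_in_chart A g c y (coord_change (chart_at A y) c y v) w
           = g y v (coord_change c (chart_at A y) y w)"
    and "metric_in_chart A g c y (coord_change (chart_at A y) c y v)
           (coord_change (chart_at A y) c y v) = g y v v"
  unfolding metric_in_chart_def
  by (simp_all add: coord_change_inverse[OF assms(1) chart_at[OF assms(1,2)] assms(3,4)])

lemma metric_in_chart_tendsto:
  assumes M: "riemannian_manifold X A g" and c: "c \<in> A" "l \<in> fst c" and lim: "limitin X y l F"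
  shows "((\<lambda>k. metric_in_chart A g c (y k) a b) \<longlongrightarrow> metric_in_chart A g c l a b) F"
proof -
  note ch = smooth_atlas_chart[OF riemannian_manifold_atlas[OF M] c(1)]
  let ?G = "\<lambda>y. metric_in_chart A g c y a b"
  have "Ck_on 0 (snd c ` fst c) (?G \<circ> chart_inv c)"
    using M c(1) unfolding riemannian_manifold_def Cinf_on_def metric_in_chart_def by blast
  then have "((\<lambda>k. (?G \<circ> chart_inv c) (snd c (y k))) \<longlongrightarrow> (?G \<circ> chart_inv c) (snd c l)) F"
    by (intro chart_coordinate_tendsto[OF ch lim c(2)]) simp
  moreover have "\<forall>\<^sub>F k in F. (?G \<circ> chart_inv c) (snd c (y k)) = ?G (y k)"
    using is_chart_tendsto(1)[OF ch lim c(2)]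
    by (rule eventually_mono) (simp add: chart_inv_left[OF ch])
  ultimately show ?thesis
    using chart_inv_left[OF ch c(2)] by (simp add: tendsto_cong)
qed

text \<open>The value of \<open>g\<close> on the diagonal is independent of coordinates, so it can be computed in one
  chart around \<open>l\<close>, where both the coefficients of \<open>g\<close> and the coordinates of \<open>v k\<close> converge.\<close>

lemma metric_tendsto:
  assumes M: "riemannian_manifold X A g" and y: "\<And>k. y k \<in> topspace X"
    and lim: "limitin X y l F" and limv: "limitin (tangent_bundle A) (\<lambda>k. (y k, v k)) (l, w) F"
  shows "((\<lambda>k. g (y k) (v k) (v k)) \<longlongrightarrow> g l w w) F"
proof -
  note at = riemannian_manifold_atlas[OF M]
  note l = limitin_topspace[OF lim]
  define c where "c = chart_at A l"
  have c: "c \<in> A" "l \<in> fst c" using chart_at[OF at l] by (auto simp: c_def)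
  note ev = is_chart_tendsto(1)[OF smooth_atlas_chart[OF at c(1)] lim c(2)]
  let ?T = "\<lambda>y. coord_change (chart_at A y) c y"
  have bil: "\<forall>\<^sub>F k in F. bilinear (metric_in_chart A g c (y k))"
    using ev by (rule eventually_mono) (rule inner_product_bilinear[OF metric_in_chart_inner[OF M c(1)]])
  note lv = tangent_bundle_chart_tendsto[OF limv c]
  have "((\<lambda>k. metric_in_chart A g c (y k) (?T (y k) (v k)) (?T (y k) (v k)))
      \<longlongrightarrow> metric_in_chart A g c l (?T l w) (?T l w)) F"
    by (rule tendsto_bilinear_form[OF bil inner_product_bilinear[OF metric_in_chart_inner[OF M c]]
        metric_in_chart_tendsto[OF M c lim] lv lv])
  moreover have "\<forall>\<^sub>F k in F. metric_in_chart A g c (y k) (?T (y k) (v k)) (?T (y k) (v k))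
      = g (y k) (v k) (v k)"
    using ev by (rule eventually_mono) (rule metric_in_chart_coord_change(2)[OF at y c(1)])
  ultimately show ?thesis
    using metric_in_chart_coord_change(2)[OF at l c] by (simp add: tendsto_cong)
qed

lemma riemannian_gradient:
  assumes "riemannian_manifold X A g" "C1_function X A f" "y \<in> topspace X"
  shows "g y (riemannian_gradient A g f y) w = differential A std_atlas f y w"
  unfolding riemannian_gradient_def
  by (rule riesz[OF riemannian_manifold_inner[OF assms(1,3)]
      linear_differential[OF riemannian_manifold_atlas[OF assms(1)] assms(2,3)]])

text \<open>In a chart around \<open>l\<close> the gradient is the Riesz representative of the derivative of the local
  representative of \<open>f\<close> with respect to the local metric; both vary continuously. The scalar \<open>r\<close>
  is present because the iteration projects \<open>- s \<nabla>f\<close>.\<close>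

lemma riemannian_gradient_tendsto:
  assumes M: "riemannian_manifold X A g" and f: "C1_function X A f"
    and y: "\<And>k. y k \<in> topspace X" and lim: "limitin X y l F"
  shows "limitin (tangent_bundle A) (\<lambda>k. (y k, r *\<^sub>R riemannian_gradient A g f (y k)))
           (l, r *\<^sub>R riemannian_gradient A g f l) F"
proof (rule limitin_tangent_bundle[OF riemannian_manifold_atlas[OF M] lim])
  fix c assume c: "c \<in> A" "l \<in> fst c"
  note at = riemannian_manifold_atlas[OF M]
  note l = limitin_topspace[OF lim]
  note ch = smooth_atlas_chart[OF at c(1)]
  note ev = is_chart_tendsto(1)[OF ch lim c(2)]
  let ?G = "\<lambda>y. coord_change (chart_at A y) c y (riemannian_gradient A g f y)"
  let ?D = "\<lambda>y. frechet_derivative (f \<circ> chart_inv c) (at (snd c y))"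
  have lin: "linear (?D z)" if "z \<in> fst c" for z
    by (rule has_derivative_linear[OF frechet_derivative_works[THEN iffD1,
          OF C1_function_chart(1)[OF at f c(1) that]]])
  have rep: "metric_in_chart A g c z (?G z) w = ?D z w" if "z \<in> topspace X" "z \<in> fst c" for z w
    by (simp only: metric_in_chart_coord_change(1)[OF at that(1) c(1) that(2)]
        riemannian_gradient[OF M f that(1)] differential_in_chart[OF at f c(1) that(2)])
  have "((\<lambda>k. ?G (y k)) \<longlongrightarrow> ?G l) F"
  proof (rule tendsto_riesz[OF metric_in_chart_inner[OF M c] lin[OF c(2)] rep[OF l c(2)]])
    show "\<forall>\<^sub>F k in F. bilinear (metric_in_chart A g c (y k)) \<and> linear (?D (y k)) \<and>
        (\<forall>w. metric_in_chart A g c (y k) (?G (y k)) w = ?D (y k) w)"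
      using ev
    proof (rule eventually_mono)
      fix k assume k: "y k \<in> fst c"
      show "bilinear (metric_in_chart A g c (y k)) \<and> linear (?D (y k)) \<and>
        (\<forall>w. metric_in_chart A g c (y k) (?G (y k)) w = ?D (y k) w)"
        using inner_product_bilinear[OF metric_in_chart_inner[OF M c(1) k]] lin[OF k] rep[OF y k]
        by blast
    qed
    show "((\<lambda>k. metric_in_chart A g c (y k) a b) \<longlongrightarrow> metric_in_chart A g c l a b) F" for a b
      by (rule metric_in_chart_tendsto[OF M c lim])
    show "((\<lambda>k. ?D (y k) w) \<longlongrightarrow> ?D l w) F" for w
      by (rule chart_coordinate_tendsto[OF ch lim c(2) C1_function_chart(2)[OF at f c(1)]])
  qed
  then have "((\<lambda>k. r *\<^sub>R ?G (y k)) \<longlongrightarrow> r *\<^sub>R ?G l) F"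
    by (intro tendsto_scaleR tendsto_const)
  moreover have "coord_change (chart_at A z) c z (r *\<^sub>R riemannian_gradient A g f z) = r *\<^sub>R ?G z"
    if "z \<in> topspace X" "z \<in> fst c" for z
    by (rule linear_cmul[OF linear_coord_change[OF at chart_at(1)[OF at that(1)] c(1)
          chart_at(2)[OF at that(1)] that(2)]])
  then have "\<forall>\<^sub>F k in F. r *\<^sub>R ?G (y k)
      = coord_change (chart_at A (y k)) c (y k) (r *\<^sub>R riemannian_gradient A g f (y k))"
    and "coord_change (chart_at A l) c l (r *\<^sub>R riemannian_gradient A g f l) = r *\<^sub>R ?G l"
    using ev y l c(2) by (auto elim: eventually_mono)
  ultimately show "((\<lambda>k. coord_change (chart_at A (y k)) c (y k) (r *\<^sub>R riemannian_gradient A g f (y k)))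
      \<longlongrightarrow> coord_change (chart_at A l) c l (r *\<^sub>R riemannian_gradient A g f l)) F"
    by (simp add: tendsto_cong)
qed

section \<open>Functions composed with the retraction\<close>

text \<open>Injectivity makes \<open>chart_inv\<close> of a bundle chart an actual inverse, which is needed to read
  the \<open>C\<^sup>1\<close> condition on \<open>R\<close> along a fiber.\<close>

lemma bundle_chart_inj:
  assumes at: "smooth_atlas X A" and c: "c \<in> A"
  shows "inj_on (snd (bundle_chart A c)) (fst (bundle_chart A c))"
proof (rule inj_onI)
  fix p q assume "p \<in> fst (bundle_chart A c)" "q \<in> fst (bundle_chart A c)"
    and eq: "snd (bundle_chart A c) p = snd (bundle_chart A c) q"
  then obtain y v z w where pq: "p = (y, v)" "q = (z, w)" and yz: "y \<in> fst c" "z \<in> fst c"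
    unfolding fst_bundle_chart by blast
  from eq have "snd c y = snd c z" by (simp add: pq bundle_chart_apply)
  then have y: "y = z" using inj_onD[OF is_chart_inj[OF smooth_atlas_chart[OF at c]]] yz by blast
  have "y \<in> topspace X" using at c yz unfolding smooth_atlas_def by blast
  note d = chart_at[OF at this]
  have "coord_change (chart_at A y) c y v = coord_change (chart_at A y) c y w"
    using eq by (simp add: pq bundle_chart_apply y)
  from arg_cong[OF this, of "coord_change c (chart_at A y) y"] have "v = w"
    by (simp only: coord_change_inverse[OF at d c yz(1)])
  then show "p = q" by (simp add: pq y)
qed

lemma open_fiber_map_vimage:
  assumes at: "smooth_atlas X A" and R: "retraction_on_manifold X A R"
    and x: "x \<in> topspace X" and U: "openin X U"
  shows "open (fiber_map R x -` U)"
proof -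
  have "continuous_map (tangent_bundle A) X R"
    using R by (simp add: retraction_on_manifold_def C1_map_def)
  from continuous_map_compose[OF continuous_map_tangent_fiber[OF at x] this]
  have "continuous_map euclidean X (fiber_map R x)"
    by (simp add: comp_def fiber_map_def[abs_def])
  from openin_continuous_map_preimage[OF this U] show ?thesis
    by (simp add: vimage_def)
qed

lemma fiber_map_in_topspace:
  assumes at: "smooth_atlas X A" and R: "retraction_on_manifold X A R" and x: "x \<in> topspace X"
  shows "fiber_map R x v \<in> topspace X"
proof -
  have "continuous_map (tangent_bundle A) X R"
    using R by (simp add: retraction_on_manifold_def C1_map_def)
  from continuous_map_image_subset_topspace[OF this] show ?thesis
    using x unfolding fiber_map_def topspace_tangent_bundle[OF at] by blast
qed

text \<open>In the bundle chart of \<open>chart_at A x\<close> the fiber over \<open>x\<close> is the affine slice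
  \<open>w \<mapsto> (snd c x, w)\<close>. The local representative of \<open>R\<close> is differentiable within its domain, so its
  restriction to the slice is differentiable within the set \<open>T\<close> of vectors that \<open>R\<^sub>x\<close> sends into
  \<open>d\<close>; as \<open>T\<close> is open in the model space, the restriction is differentiable there.\<close>

lemma fiber_map_differentiable:
  assumes at: "smooth_atlas X A" and R: "retraction_on_manifold X A R" and x: "x \<in> topspace X"
    and d: "d \<in> A" "fiber_map R x v \<in> fst d"
  shows "snd d \<circ> fiber_map R x differentiable at v"
proof -
  define c where "c = chart_at A x"
  have c: "c \<in> A" "x \<in> fst c" using chart_at[OF at x] by (auto simp: c_def)
  define b where "b = bundle_chart A c"
  define T where "T = fiber_map R x -` fst d"
  define j where "j = (\<lambda>w. snd b (x, w))"
  have j: "j = (\<lambda>w. (snd c x, w))"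
    by (rule ext) (simp add: j_def b_def bundle_chart_apply c_def[symmetric] coord_change_self[OF at c])
  have inv: "chart_inv b (j w) = (x, w)" for w
    unfolding chart_inv_def j_def b_def
    by (rule inv_into_f_f[OF bundle_chart_inj[OF at c(1)]]) (simp add: fst_bundle_chart c(2))
  define P where "P = snd b ` (fst b \<inter> R -` fst d)"
  have "\<forall>b\<in>tangent_atlas A. \<forall>d\<in>A. Ck_on 1 (snd b ` (fst b \<inter> R -` fst d)) (snd d \<circ> R \<circ> chart_inv b)"
    using R unfolding retraction_on_manifold_def C1_map_def by blast
  moreover have "b \<in> tangent_atlas A" using c(1) by (simp add: b_def tangent_atlas_def)
  ultimately have "Ck_on 1 P (snd d \<circ> R \<circ> chart_inv b)" using d(1) unfolding P_def by blast
  then have diff: "snd d \<circ> R \<circ> chart_inv b differentiable_on P" by simp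
  have sub: "j ` T \<subseteq> P"
    using c(2) by (auto simp: T_def P_def j_def fiber_map_def b_def fst_bundle_chart)
  have v: "v \<in> T" using d(2) by (simp add: T_def)
  have "snd d \<circ> R \<circ> chart_inv b differentiable at (j v) within j ` T"
    using diff sub v unfolding differentiable_on_def
    by (meson differentiable_within_subset image_eqI subsetD)
  moreover have "j differentiable at v within T" unfolding j by (rule derivative_intros) simp_all
  ultimately have "snd d \<circ> R \<circ> chart_inv b \<circ> j differentiable at v within T"
    by (intro differentiable_chain_within)
  moreover have "snd d \<circ> R \<circ> chart_inv b \<circ> j = snd d \<circ> fiber_map R x"
    by (rule ext) (simp add: inv fiber_map_def)
  moreover have "open T"
    unfolding T_def using smooth_atlas_chart[OF at d(1)]
    by (intro open_fiber_map_vimage[OF at R x]) (simp add: is_chart_def)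
  ultimately show ?thesis using at_within_open[OF v] by simp
qed

lemma fiber_function_has_derivative:
  assumes at: "smooth_atlas X A" and R: "retraction_on_manifold X A R" and x: "x \<in> topspace X"
    and f: "C1_function X A f" and d: "d \<in> A" "fiber_map R x v \<in> fst d"
  shows "(f \<circ> fiber_map R x has_derivative
      frechet_derivative (f \<circ> chart_inv d) (at (snd d (fiber_map R x v)))
        \<circ> frechet_derivative (snd d \<circ> fiber_map R x) (at v)) (at v)"
proof -
  note ch = smooth_atlas_chart[OF at d(1)]
  have 1: "(snd d \<circ> fiber_map R x has_derivative frechet_derivative (snd d \<circ> fiber_map R x) (at v)) (at v)"
    using fiber_map_differentiable[OF at R x d] by (simp only: frechet_derivative_works)
  have 2: "(f \<circ> chart_inv d has_derivative
      frechet_derivative (f \<circ> chart_inv d) (at (snd d (fiber_map R x v))))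
      (at ((snd d \<circ> fiber_map R x) v))"
    using C1_function_chart(1)[OF at f d] by (simp only: frechet_derivative_works comp_apply)
  show ?thesis
  proof (rule has_derivative_transform_within_open[OF diff_chain_at[OF 1 2]])
    show "open (fiber_map R x -` fst d)"
      using ch by (intro open_fiber_map_vimage[OF at R x]) (simp add: is_chart_def)
    show "v \<in> fiber_map R x -` fst d" using d(2) by simp
    show "((f \<circ> chart_inv d) \<circ> (snd d \<circ> fiber_map R x)) w = (f \<circ> fiber_map R x) w"
      if "w \<in> fiber_map R x -` fst d" for w
      using that by (simp add: chart_inv_left[OF ch])
  qed
qed

lemma fiber_function_differentiable:
  assumes at: "smooth_atlas X A" and R: "retraction_on_manifold X A R" and x: "x \<in> topspace X"
    and f: "C1_function X A f"
  shows "f \<circ> fiber_map R x differentiable at v"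
  using fiber_function_has_derivative[OF at R x f chart_at[OF at fiber_map_in_topspace[OF at R x]]]
  by (rule differentiableI)

text \<open>The identity differential of the retraction enters here: the gradient of \<open>f \<circ> R\<^sub>x\<close> at \<open>0\<close> is the
  Riemannian gradient of \<open>f\<close> at \<open>x\<close>.\<close>

lemma fiber_function_derivative_0:
  assumes at: "smooth_atlas X A" and R: "retraction_on_manifold X A R" and x: "x \<in> topspace X"
    and f: "C1_function X A f"
  shows "frechet_derivative (f \<circ> fiber_map R x) (at 0) = differential A std_atlas f x"
proof -
  have R0: "fiber_map R x 0 = x" and dR: "differential std_atlas A (fiber_map R x) 0 = (\<lambda>v. v)"
    using R x unfolding retraction_on_manifold_def by blast+
  have x0: "fiber_map R x 0 \<in> fst (chart_at A x)" using chart_at(2)[OF at x] R0 by simp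
  have "frechet_derivative (snd (chart_at A x) \<circ> fiber_map R x) (at 0) = (\<lambda>v. v)"
    using dR by (simp add: differential_std_domain R0)
  with frechet_derivative_at[OF fiber_function_has_derivative[OF at R x f chart_at(1)[OF at x] x0]]
  show ?thesis by (simp add: R0 differential_std_codomain comp_def)
qed

section \<open>Sufficient decrease and stationarity\<close>

text \<open>Along the ray \<open>t \<mapsto> t p\<close> the derivative of \<open>h\<close> exceeds its value at \<open>t = 0\<close> by at most
  \<open>L t \<parallel>p\<parallel>\<^sup>2\<close>, by Cauchy-Schwarz. Monotonicity of the difference \<open>\<phi>\<close> stands in for integrating
  this bound.\<close>

lemma descent_inequality:
  fixes h :: "'e::euclidean_space \<Rightarrow> real"
  assumes ip: "inner_product ip" and h: "\<And>v. h differentiable at v"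
    and lip: "\<And>t. 0 \<le> t \<Longrightarrow> t \<le> 1 \<Longrightarrow>
      ip_norm ip (ip_gradient ip h (t *\<^sub>R p) - ip_gradient ip h 0) \<le> L * ip_norm ip (t *\<^sub>R p)"
  shows "h p \<le> h 0 + frechet_derivative h (at 0) p + L / 2 * ip p p"
proof -
  let ?D = "\<lambda>v. frechet_derivative h (at v)"
  have hd: "(h has_derivative ?D v) (at v)" for v using h by (simp only: frechet_derivative_works)
  have grad: "ip (ip_gradient ip h v) w = ?D v w" for v w
    unfolding ip_gradient_def by (rule riesz[OF ip has_derivative_linear[OF hd]])
  define \<phi> where "\<phi> t = h (t *\<^sub>R p) - t * ?D 0 p - L / 2 * ip p p * t\<^sup>2" for t
  have "\<phi> 1 \<le> \<phi> 0"
  proof (rule DERIV_nonpos_imp_nonincreasing[of 0 1 \<phi>])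
    fix t :: real assume t: "0 \<le> t" "t \<le> 1"
    have "((\<lambda>t. t *\<^sub>R p) has_derivative (\<lambda>r. r *\<^sub>R p)) (at t)"
      by (auto intro!: derivative_eq_intros)
    from has_derivative_compose[OF this hd]
    have "((\<lambda>t. h (t *\<^sub>R p)) has_derivative (\<lambda>r. ?D (t *\<^sub>R p) (r *\<^sub>R p))) (at t)" .
    moreover have "?D (t *\<^sub>R p) (r *\<^sub>R p) = ?D (t *\<^sub>R p) p * r" for r
      using linear_cmul[OF has_derivative_linear[OF hd]] by simp
    ultimately have "((\<lambda>t. h (t *\<^sub>R p)) has_field_derivative ?D (t *\<^sub>R p) p) (at t)"
      by (simp add: has_field_derivative_def)
    then have "(\<phi> has_field_derivative ?D (t *\<^sub>R p) p - ?D 0 p - L * ip p p * t) (at t)"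
      unfolding \<phi>_def by (auto intro!: derivative_eq_intros)
    moreover have "?D (t *\<^sub>R p) p - ?D 0 p \<le> L * ip p p * t"
    proof -
      have "?D (t *\<^sub>R p) p - ?D 0 p = ip (ip_gradient ip h (t *\<^sub>R p) - ip_gradient ip h 0) p"
        by (simp only: bilinear_lsub[OF inner_product_bilinear[OF ip]] grad)
      also have "\<dots> \<le> ip_norm ip (ip_gradient ip h (t *\<^sub>R p) - ip_gradient ip h 0) * ip_norm ip p"
        by (rule ip_Cauchy_Schwarz[OF ip])
      also have "\<dots> \<le> L * ip_norm ip (t *\<^sub>R p) * ip_norm ip p"
        by (intro mult_right_mono lip t) (simp add: ip_norm_def inner_product_nonneg[OF ip])
      also have "\<dots> = L * t * (ip_norm ip p)\<^sup>2"
        by (simp add: ip_norm_scale[OF ip t(1)] power2_eq_square)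
      finally show ?thesis by (simp add: ip_norm_square[OF ip] mult_ac)
    qed
    ultimately show "\<exists>y. (\<phi> has_field_derivative y) (at t) \<and> y \<le> 0"
      by (intro exI[of _ "?D (t *\<^sub>R p) p - ?D 0 p - L * ip p p * t"]) auto
  qed simp
  then show ?thesis by (simp add: \<phi>_def)
qed

lemma R_convex_projection_tendsto:
  assumes CK: "R_convex X A g R C K" and y: "\<And>k. y k \<in> C" "l \<in> C" "limitin X y l sequentially"
    and v: "limitin (tangent_bundle A) (\<lambda>k. (y k, v k)) (l, w) sequentially"
  shows "limitin (tangent_bundle A) (\<lambda>k. (y k, ip_projection (g (y k)) (K (y k)) (v k)))
           (l, ip_projection (g l) (K l) w) sequentially"
  by (rule CK[unfolded R_convex_def, THEN conjunct2, THEN conjunct2, THEN conjunct2,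
        THEN spec[where x = y], THEN spec[where x = v], THEN spec[where x = l],
        THEN spec[where x = w], THEN mp])
     (intro conjI allI y v)

text \<open>The point \<open>0\<close> of \<open>K x\<close> serves twice: as competitor for the projection, which bounds the
  first-order term by \<open>- 1/s \<parallel>p\<parallel>\<^sup>2\<close>, and as endpoint of the segment to \<open>p\<close>, which convexity keeps
  inside the set where the Lipschitz bound holds.\<close>

lemma projected_step_decrease:
  assumes M: "riemannian_manifold X A g" and R: "retraction_on_manifold X A R"
    and f: "C1_function X A f" and CK: "R_convex X A g R C K"
    and Lip: "R_Lipschitz_gradient g R f C K L" and s: "0 < s" and x: "x \<in> C"
    and p_def: "p = ip_projection (g x) (K x) (- s *\<^sub>R riemannian_gradient A g f x)"
  shows "p \<in> K x" and "(1 / s - L / 2) * g x p p \<le> f x - f (fiber_map R x p)"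
proof -
  note at = riemannian_manifold_atlas[OF M]
  have xX: "x \<in> topspace X" using CK x closedin_subset unfolding R_convex_def by blast
  note ip = riemannian_manifold_inner[OF M xX]
  note b = inner_product_bilinear[OF ip]
  have K: "closed (K x)" "convex (K x)" "0 \<in> K x" using CK x unfolding R_convex_def by blast+
  then have ne: "K x \<noteq> {}" by blast
  show p: "p \<in> K x" unfolding p_def by (rule ip_projection(1)[OF ip K(1,2) ne])
  let ?G = "riemannian_gradient A g f x" and ?h = "f \<circ> fiber_map R x"
  have "g x (- s *\<^sub>R ?G - p) (0 - p) \<le> 0"
    unfolding p_def by (rule ip_projection(2)[OF ip K(1,2) ne K(3)])
  then have "s * g x ?G p + g x p p \<le> 0"
    by (simp add: bilinear_lsub[OF b] bilinear_rneg[OF b] bilinear_lneg[OF b] bilinear_lmul[OF b])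
  then have df: "differential A std_atlas f x p \<le> - (1 / s) * g x p p"
    using s by (simp add: riemannian_gradient[OF M f xX] field_simps)
  have "?h p \<le> ?h 0 + frechet_derivative ?h (at 0) p + L / 2 * g x p p"
  proof (rule descent_inequality[OF ip fiber_function_differentiable[OF at R xX f]])
    fix t :: real assume "0 \<le> t" "t \<le> 1"
    then have "t *\<^sub>R p \<in> K x"
      using convexD_alt[OF K(2,3) p, of t] by simp
    then show "ip_norm (g x) (ip_gradient (g x) ?h (t *\<^sub>R p) - ip_gradient (g x) ?h 0)
        \<le> L * ip_norm (g x) (t *\<^sub>R p)"
      using Lip x unfolding R_Lipschitz_gradient_def by blast
  qed
  moreover have "fiber_map R x 0 = x" using R xX unfolding retraction_on_manifold_def by blast
  ultimately have "f (fiber_map R x p) \<le> f x + differential A std_atlas f x p + L / 2 * g x p p"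
    by (simp add: fiber_function_derivative_0[OF at R xX f])
  then show "(1 / s - L / 2) * g x p p \<le> f x - f (fiber_map R x p)"
    using df by (simp add: algebra_simps)
qed

text \<open>If \<open>0\<close> is the point of \<open>K x\<close> nearest to \<open>- s \<nabla>f\<close>, its variational inequality against \<open>v\<close> reads
  \<open>- s df v \<le> 0\<close>.\<close>

lemma stationary_if_projection_0:
  assumes M: "riemannian_manifold X A g" and f: "C1_function X A f"
    and CK: "R_convex X A g R C K" and s: "0 < s" and x: "x \<in> C"
    and 0: "ip_projection (g x) (K x) (- s *\<^sub>R riemannian_gradient A g f x) = 0"
  shows "stationary_point A f C K x"
  unfolding stationary_point_def
proof (intro conjI ballI x)
  have xX: "x \<in> topspace X" using CK x closedin_subset unfolding R_convex_def by blast
  note ip = riemannian_manifold_inner[OF M xX]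
  have K: "closed (K x)" "convex (K x)" "0 \<in> K x" using CK x unfolding R_convex_def by blast+
  then have ne: "K x \<noteq> {}" by blast
  fix v assume "v \<in> K x"
  from ip_projection(2)[OF ip K(1,2) ne this, of "- s *\<^sub>R riemannian_gradient A g f x"]
  have "g x (- s *\<^sub>R riemannian_gradient A g f x) v \<le> 0" by (simp only: 0 diff_zero)
  then have "- s * differential A std_atlas f x v \<le> 0"
    by (simp only: bilinear_lmul[OF inner_product_bilinear[OF ip]] riemannian_gradient[OF M f xX]
        real_scaleR_def)
  then show "0 \<le> differential A std_atlas f x v" using s by (simp add: zero_le_mult_iff)
qed

theorem proposition3p9:
  fixes X :: "'a topology"
    and A :: "('a, 'e::euclidean_space) chart set"
    and g :: "'a \<Rightarrow> 'e \<Rightarrow> 'e \<Rightarrow> real"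
    and R :: "'a \<times> 'e \<Rightarrow> 'a"
    and f :: "'a \<Rightarrow> real"
    and C :: "'a set"
    and K :: "'a \<Rightarrow> 'e set"
    and L s :: real
    and x :: "nat \<Rightarrow> 'a"
  assumes "riemannian_manifold X A g"
    and "retraction_on_manifold X A R"
    and "C1_function X A f"
    and "R_convex X A g R C K"
    and "R_Lipschitz_gradient g R f C K L"
    and "0 < s" and "s < 2 / L"
    and "x 0 \<in> C"
    and "\<And>k. x (Suc k) = fiber_map R (x k)
            (ip_projection (g (x k)) (K (x k)) (- s *\<^sub>R riemannian_gradient A g f (x k)))"
  shows "\<forall>l. limit_point X x l \<longrightarrow> stationary_point A f C K l"
proof (intro allI impI)
  note M = assms(1) and R = assms(2) and f = assms(3) and CK = assms(4) and Lip = assms(5)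
    and s = assms(6)
  fix l assume "limit_point X x l"
  then obtain r where r: "strict_mono r" and lim: "limitin X (x \<circ> r) l sequentially"
    unfolding limit_point_def by blast
  define G where "G y = - s *\<^sub>R riemannian_gradient A g f y" for y
  define p where "p y = ip_projection (g y) (K y) (G y)" for y
  define c where "c = 1 / s - L / 2"
  have "L > 0" using Lip unfolding R_Lipschitz_gradient_def by blast
  then have c: "c > 0" using s assms(7) by (simp add: c_def field_simps)
  note step = projected_step_decrease[OF M R f CK Lip s _ p_def[unfolded G_def], folded c_def]
  have C: "x k \<in> C" for k
  proof (induction k)
    case (Suc k)
    have "fiber_map R (x k) ` K (x k) \<subseteq> C" using CK Suc unfolding R_convex_def by blast
    then show ?case using step(1)[OF Suc] by (auto simp: assms(9) p_def G_def)
  qed (rule assms(8))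
  have CX: "closedin X C" "C \<subseteq> topspace X" using CK closedin_subset unfolding R_convex_def by blast+
  have l: "l \<in> C"
    by (rule limitin_closedin[OF lim CX(1)]) (auto simp: C)
  have decr: "c * g (x k) (p (x k)) (p (x k)) \<le> f (x k) - f (x (Suc k))" for k
    using step(2)[OF C] by (simp add: assms(9) p_def G_def)
  have nonneg: "0 \<le> c * g (x k) (p (x k)) (p (x k))" for k
    using c CX(2) C inner_product_nonneg[OF riemannian_manifold_inner[OF M]]
    by (intro mult_nonneg_nonneg) auto
  have "decseq (\<lambda>k. f (x k))"
    using order_trans[OF nonneg decr] by (intro decseq_SucI) simp
  have "limitin euclidean (f \<circ> (x \<circ> r)) (f l) sequentially"
    using f unfolding C1_function_def C1_map_def
    by (intro continuous_map_limit[OF _ lim]) blast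
  then have fr: "(\<lambda>k. f (x (r k))) \<longlonglongrightarrow> f l" by (simp add: comp_def)
  \<comment> \<open>The tail of the subsequence lies beyond \<open>k\<close>, where \<open>f\<close> is at most \<open>f (x k)\<close>.\<close>
  have lower: "f l \<le> f (x k)" for k
  proof (rule LIMSEQ_le_const2[OF fr], intro exI allI impI)
    fix j assume "k \<le> j"
    then have "k \<le> r j" using seq_suble[OF r, of j] by simp
    then show "f (x (r j)) \<le> f (x k)" using \<open>decseq _\<close> by (simp add: decseq_def)
  qed
  have "(\<lambda>k. c * g (x (r k)) (p (x (r k))) (p (x (r k)))) \<longlonglongrightarrow> 0"
  proof (rule tendsto_sandwich[OF always_eventually always_eventually tendsto_const])
    show "\<forall>k. 0 \<le> c * g (x (r k)) (p (x (r k))) (p (x (r k)))" using nonneg by blast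
    show "\<forall>k. c * g (x (r k)) (p (x (r k))) (p (x (r k))) \<le> f (x (r k)) - f l"
      using decr lower by (meson diff_left_mono order_trans)
    show "(\<lambda>k. f (x (r k)) - f l) \<longlonglongrightarrow> 0" using LIM_zero[OF fr] .
  qed
  moreover have "(\<lambda>k. g (x (r k)) (p (x (r k))) (p (x (r k)))) \<longlonglongrightarrow> g l (p l) (p l)"
  proof -
    have lim': "limitin X (\<lambda>k. x (r k)) l sequentially" using lim by (simp add: comp_def)
    have X: "x (r k) \<in> topspace X" for k using C CX(2) by blast
    have "limitin (tangent_bundle A) (\<lambda>k. (x (r k), G (x (r k)))) (l, G l) sequentially"
      unfolding G_def by (rule riemannian_gradient_tendsto[OF M f X lim'])
    then have "limitin (tangent_bundle A) (\<lambda>k. (x (r k), p (x (r k)))) (l, p l) sequentially"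
      unfolding p_def by (rule R_convex_projection_tendsto[OF CK C l lim'])
    then show ?thesis by (rule metric_tendsto[OF M X lim'])
  qed
  then have "(\<lambda>k. c * g (x (r k)) (p (x (r k))) (p (x (r k)))) \<longlonglongrightarrow> c * g l (p l) (p l)"
    by (intro tendsto_mult tendsto_const)
  ultimately have "c * g l (p l) (p l) = 0" by (rule LIMSEQ_unique[rotated])
  then have "g l (p l) (p l) \<le> 0" using c by simp
  then have "p l = 0"
    using l CX(2) by (intro inner_product_eq_0[OF riemannian_manifold_inner[OF M]]) auto
  then show "stationary_point A f C K l"
    by (intro stationary_if_projection_0[OF M f CK s l]) (simp add: p_def G_def)
qed

end
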